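(* Let $n\in\mathbb{N}$ and let $X, Y$ be two centered Gaussian random vectors in $\mathbb{R}^n$ such that $d_X(i,j)\le d_Y(i,j)$ for all $i,j\in[n]$. Assume that $f:\mathbb{R}^n\to\mathbb{R}$ is a $C^2$ function, that $f$ and all its partial derivatives up to order 2 are of moderate growth, and that $f$ satisfies the following properties: (a) for all $x\in\mathbb{R}^n$ and all $u\in\mathbb{R}$, $f(x+u\mathbf{1})=f(x)+u$; (b) for all $i\in[n]$, $\partial_i f\ge 0$ on $\mathbb{R}^n$; (c) for all $i\neq j$ in $[n]$, $\partial^2_{ij}f\le 0$ on $\mathbb{R}^n$; (d) for all $x\in\mathbb{R}^n$, $f(x)\ge \max_{1\le i\le n}x_i$; (e) $\lambda\in\mathbb{R}$ is a real number such that for all $i\neq j$ in $[n]$, $\partial_i f\,\partial_j f+\lambda\,\partial^2_{ij}f\le 0$ on $\mathbb{R}^n$ (such a $\lambda$ is assumed to exist). Then $$\mathbb{E}\left[\left(\mathrm{P}_{H_X^\perp}(f(X))+\lambda\right)^2\right]\le \mathbb{E}\left[\left(\mathrm{P}_{H_Y^\perp}(f(Y))+\lambda\right)^2\right].$$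
   Context: $[n]=\{1,\dots,n\}$ and $\mathbf{1}=(1,\dots,1)\in\mathbb{R}^n$; $|x|$ is the Euclidean norm. For a centered Gaussian random vector $X=(X_1,\dots,X_n)$ (its covariance matrix may be singular), $d_X(i,j)=(\mathbb{E}[(X_i-X_j)^2])^{1/2}$. $H_X=\mathrm{span}(X_1,\dots,X_n)\subset L^2(\Omega,\mathbb{P})$, where $(\Omega,\mathbb{P})$ is the underlying probability space, and $\mathrm{P}_{H_X}$, $\mathrm{P}_{H_X^\perp}$ are the orthogonal projections of $L^2(\Omega,\mathbb{P})$ onto $H_X$ and onto its orthogonal complement $H_X^\perp$. A function $g:\mathbb{R}^n\to\mathbb{R}$ is of moderate growth if for each $a>0$, $\lim_{|x|\to+\infty}g(x)e^{-a|x|^2}=0$. *)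

theory Defs
  imports "HOL-Probability.Probability"
begin

section \<open>Gaussian random vectors\<close>

text \<open>Degenerate (almost surely constant) variables count as Gaussian, so that covariance
  matrices may be singular.\<close>

definition gaussian_rv :: "'a measure \<Rightarrow> ('a \<Rightarrow> real) \<Rightarrow> bool" where
  "gaussian_rv M Z \<longleftrightarrow> Z \<in> borel_measurable M \<and>
     (\<exists>\<mu>. (AE \<omega> in M. Z \<omega> = \<mu>) \<or> (\<exists>\<sigma>>0. distributed M lborel Z (normal_density \<mu> \<sigma>)))"

definition gaussian_vector :: "'a measure \<Rightarrow> ('a \<Rightarrow> real ^ 'n) \<Rightarrow> bool" where
  "gaussian_vector M X \<longleftrightarrow> X \<in> borel_measurable M \<and> (\<forall>a. gaussian_rv M (\<lambda>\<omega>. a \<bullet> X \<omega>))"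

definition centered_gaussian_vector :: "'a measure \<Rightarrow> ('a \<Rightarrow> real ^ 'n) \<Rightarrow> bool" where
  "centered_gaussian_vector M X \<longleftrightarrow>
     gaussian_vector M X \<and> (\<forall>i. (\<integral>\<omega>. X \<omega> $ i \<partial>M) = 0)"

definition canonical_dist :: "'a measure \<Rightarrow> ('a \<Rightarrow> real ^ 'n) \<Rightarrow> 'n \<Rightarrow> 'n \<Rightarrow> real" where
  "canonical_dist M X i j = sqrt (\<integral>\<omega>. (X \<omega> $ i - X \<omega> $ j)\<^sup>2 \<partial>M)"

section \<open>Orthogonal projections in the space of square-integrable random variables\<close>

text \<open>Elements of \<open>L\<^sup>2\<close> are represented by functions rather than by classes modulo
  almost-sure equality.\<close>

definition L2 :: "'a measure \<Rightarrow> ('a \<Rightarrow> real) set" where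
  "L2 M = {g \<in> borel_measurable M. integrable M (\<lambda>\<omega>. (g \<omega>)\<^sup>2)}"

definition orth_compl :: "'a measure \<Rightarrow> ('a \<Rightarrow> real) set \<Rightarrow> ('a \<Rightarrow> real) set" where
  "orth_compl M H = {g \<in> L2 M. \<forall>h\<in>H. (\<integral>\<omega>. g \<omega> * h \<omega> \<partial>M) = 0}"

text \<open>A representative of the orthogonal projection of \<open>g\<close> onto \<open>H\<close>; by
  \<open>orth_proj_AE_unique\<close> below, the choice of representative is immaterial.\<close>

definition orth_proj :: "'a measure \<Rightarrow> ('a \<Rightarrow> real) set \<Rightarrow> ('a \<Rightarrow> real) \<Rightarrow> 'a \<Rightarrow> real" where
  "orth_proj M H g = (SOME h. h \<in> H \<and> (\<lambda>\<omega>. g \<omega> - h \<omega>) \<in> orth_compl M H)"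

definition gaussian_space :: "('a \<Rightarrow> real ^ 'n) \<Rightarrow> ('a \<Rightarrow> real) set" where
  "gaussian_space X = {\<lambda>\<omega>. \<Sum>i\<in>UNIV. c i * X \<omega> $ i | c. True}"

lemma L2_mult_integrable:
  assumes "g \<in> L2 M" "h \<in> L2 M"
  shows "integrable M (\<lambda>\<omega>. g \<omega> * h \<omega>)"
proof (rule Bochner_Integration.integrable_bound)
  show "integrable M (\<lambda>\<omega>. (g \<omega>)\<^sup>2 + (h \<omega>)\<^sup>2)"
    using assms by (auto simp: L2_def)
  show "(\<lambda>\<omega>. g \<omega> * h \<omega>) \<in> borel_measurable M"
    using assms by (auto simp: L2_def)
  have "\<bar>a * b\<bar> \<le> a\<^sup>2 + b\<^sup>2" for a b :: real
  proof -
    have "0 \<le> (\<bar>a\<bar> - \<bar>b\<bar>)\<^sup>2" by simp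
    then have "2 * \<bar>a * b\<bar> \<le> a\<^sup>2 + b\<^sup>2"
      by (simp add: power2_diff abs_mult)
    then show ?thesis by linarith
  qed
  then show "AE \<omega> in M. norm (g \<omega> * h \<omega>) \<le> norm ((g \<omega>)\<^sup>2 + (h \<omega>)\<^sup>2)"
    by simp
qed

lemma orth_proj_AE_unique:
  assumes H: "H \<subseteq> L2 M"
    and p: "p \<in> H" "(\<lambda>\<omega>. g \<omega> - p \<omega>) \<in> orth_compl M H"
    and q: "q \<in> H" "(\<lambda>\<omega>. g \<omega> - q \<omega>) \<in> orth_compl M H"
  shows "AE \<omega> in M. p \<omega> = q \<omega>"
proof -
  have L: "p \<in> L2 M" "q \<in> L2 M" "(\<lambda>\<omega>. g \<omega> - p \<omega>) \<in> L2 M" "(\<lambda>\<omega>. g \<omega> - q \<omega>) \<in> L2 M"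
    using H p q by (auto simp: orth_compl_def)
  have eq: "(p \<omega> - q \<omega>)\<^sup>2 = ((g \<omega> - q \<omega>) * p \<omega> - (g \<omega> - p \<omega>) * p \<omega>)
      - ((g \<omega> - q \<omega>) * q \<omega> - (g \<omega> - p \<omega>) * q \<omega>)" for \<omega>
    by (simp add: power2_eq_square algebra_simps)
  note int = L2_mult_integrable[OF L(4,1)] L2_mult_integrable[OF L(3,1)]
    L2_mult_integrable[OF L(4,2)] L2_mult_integrable[OF L(3,2)]
  have "integrable M (\<lambda>\<omega>. (p \<omega> - q \<omega>)\<^sup>2)"
    unfolding eq using int by (intro Bochner_Integration.integrable_diff)
  moreover have "(\<integral>\<omega>. (p \<omega> - q \<omega>)\<^sup>2 \<partial>M) = 0"
    unfolding eq using int p q by (simp add: orth_compl_def)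
  ultimately have "AE \<omega> in M. (p \<omega> - q \<omega>)\<^sup>2 = 0"
    by (subst (asm) integral_nonneg_eq_0_iff_AE) auto
  then show ?thesis by simp
qed

section \<open>Functions of several real variables\<close>

definition partial_deriv :: "'n \<Rightarrow> (real ^ 'n \<Rightarrow> real) \<Rightarrow> real ^ 'n \<Rightarrow> real" where
  "partial_deriv i f x = deriv (\<lambda>t. f (x + t *\<^sub>R axis i 1)) 0"

definition C1_fun :: "(real ^ 'n \<Rightarrow> real) \<Rightarrow> bool" where
  "C1_fun f \<longleftrightarrow> f differentiable_on UNIV \<and> (\<forall>i. continuous_on UNIV (partial_deriv i f))"

definition C2_fun :: "(real ^ 'n \<Rightarrow> real) \<Rightarrow> bool" where
  "C2_fun f \<longleftrightarrow> C1_fun f \<and> (\<forall>i. C1_fun (partial_deriv i f))"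

definition moderate_growth :: "(real ^ 'n \<Rightarrow> real) \<Rightarrow> bool" where
  "moderate_growth g \<longleftrightarrow>
     (\<forall>a>0. ((\<lambda>x. g x * exp (- a * (norm x)\<^sup>2)) \<longlongrightarrow> 0) at_infinity)"

end

theory Submission
  imports Defs
begin

text \<open>
  By Gaussian integration by parts, the projection of \<open>f(X)\<close> onto \<open>H\<^sub>X\<close> is \<open>\<langle>p, X\<rangle>\<close> with
  \<open>p = E \<nabla>f(X)\<close>, a probability vector by (a) and (b). Hence the quantity to be compared is
  \<open>min\<^sub>q \<Psi>(q)\<close>, where \<open>\<Psi>(q) = E (f(X) - \<langle>q, X\<rangle> + \<lambda>)\<^sup>2\<close>, and the minimum is attained at \<open>p\<close>.

  Take \<open>X\<close> and \<open>Y\<close> independent, put \<open>X\<^sub>\<theta> = cos \<theta> X + sin \<theta> Y\<close>, and denote the corresponding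
  objects by \<open>\<Psi>\<^sub>\<theta>\<close> and \<open>p\<^sub>\<theta>\<close>. For a probability vector \<open>q\<close> the matrix
  \<open>m\<^sub>l\<^sub>j = E [(\<partial>\<^sub>j f - q\<^sub>j)(\<partial>\<^sub>l f - q\<^sub>l) + (f - \<langle>q, \<cdot>\<rangle> + \<lambda>) \<partial>\<^sub>j\<^sub>l f]\<close> has vanishing row and column sums
  by (a), so that the derivative of \<open>\<Psi>\<^sub>\<theta>(q)\<close> depends on the covariances only through
  \<open>\<delta>\<^sub>l\<^sub>j = d\<^sub>Y(l,j)\<^sup>2 - d\<^sub>X(l,j)\<^sup>2 \<ge> 0\<close>: it equals \<open>- sin \<theta> cos \<theta> \<Sum> \<delta>\<^sub>l\<^sub>j m\<^sub>l\<^sub>j\<close>. For \<open>l \<noteq> j\<close>, (c), (d) and (e)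
  give \<open>m\<^sub>l\<^sub>j \<le> (q\<^sub>l - p\<^sub>l)(q\<^sub>j - p\<^sub>j)\<close> with \<open>p = p\<^sub>\<theta>\<close>. This error is quadratic in \<open>q - p\<^sub>\<theta>\<close>; freezing
  \<open>q = p\<^sub>t\<close> on short intervals that end at \<open>t\<close> and using only the continuity of \<open>\<theta> \<mapsto> p\<^sub>\<theta>\<close>, one gets that
  \<open>\<Psi>\<^sub>\<theta>(p\<^sub>\<theta>)\<close> is nondecreasing on \<open>[0, \<pi>/2]\<close>, without third derivatives of \<open>f\<close>.
\<close>

section \<open>Functions of moderate growth and Gaussian vectors\<close>

text \<open>Unlike \<open>moderate_growth\<close>, this makes sense on product spaces and is visibly closed under products;
  for continuous functions on \<open>\<real>\<^sup>n\<close> moderate growth implies it.\<close>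

definition subgaussian_growth :: "('b::real_normed_vector \<Rightarrow> real) \<Rightarrow> bool" where
  "subgaussian_growth g \<longleftrightarrow> (\<forall>a>0. \<exists>C. \<forall>x. \<bar>g x\<bar> \<le> C * exp (a * (norm x)\<^sup>2))"

lemma subgaussian_growthE:
  assumes "subgaussian_growth g" "a > 0"
  obtains C where "C > 0" "\<And>x. \<bar>g x\<bar> \<le> C * exp (a * (norm x)\<^sup>2)"
proof -
  obtain C where C: "\<And>x. \<bar>g x\<bar> \<le> C * exp (a * (norm x)\<^sup>2)"
    using assms unfolding subgaussian_growth_def by blast
  have "\<bar>g x\<bar> \<le> (\<bar>C\<bar> + 1) * exp (a * (norm x)\<^sup>2)" for x
    by (rule order_trans[OF C]) (intro mult_right_mono, auto)
  then show ?thesis using that[of "\<bar>C\<bar> + 1"] by auto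
qed

lemma subgaussian_growth_const: "subgaussian_growth (\<lambda>x::'b::real_normed_vector. c)"
  unfolding subgaussian_growth_def
proof (intro allI impI exI)
  fix a :: real and x :: 'b assume "a > 0"
  then show "\<bar>c\<bar> \<le> \<bar>c\<bar> * exp (a * (norm x)\<^sup>2)"
    by (simp add: mult_le_cancel_left1)
qed

lemma subgaussian_growth_add:
  assumes "subgaussian_growth g" "subgaussian_growth h"
  shows "subgaussian_growth (\<lambda>x. g x + h x)"
  unfolding subgaussian_growth_def
proof (intro allI impI)
  fix a :: real assume "a > 0"
  with assms obtain C D where
    "\<And>x. \<bar>g x\<bar> \<le> C * exp (a * (norm x)\<^sup>2)" "\<And>x. \<bar>h x\<bar> \<le> D * exp (a * (norm x)\<^sup>2)"
    unfolding subgaussian_growth_def by metis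
  then have "\<bar>g x + h x\<bar> \<le> (C + D) * exp (a * (norm x)\<^sup>2)" for x
    using abs_triangle_ineq[of "g x" "h x"] by (smt (verit) distrib_right)
  then show "\<exists>C. \<forall>x. \<bar>g x + h x\<bar> \<le> C * exp (a * (norm x)\<^sup>2)" by blast
qed

lemma subgaussian_growth_mult:
  assumes "subgaussian_growth g" "subgaussian_growth h"
  shows "subgaussian_growth (\<lambda>x. g x * h x)"
  unfolding subgaussian_growth_def
proof (intro allI impI)
  fix a :: real assume "a > 0"
  then have a: "a / 2 > 0" by simp
  obtain C where C: "C > 0" "\<And>x. \<bar>g x\<bar> \<le> C * exp (a / 2 * (norm x)\<^sup>2)"
    using subgaussian_growthE[OF assms(1) a] by blast
  obtain D where D: "D > 0" "\<And>x. \<bar>h x\<bar> \<le> D * exp (a / 2 * (norm x)\<^sup>2)"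
    using subgaussian_growthE[OF assms(2) a] by blast
  have "\<bar>g x * h x\<bar> \<le> (C * D) * exp (a * (norm x)\<^sup>2)" for x
  proof -
    have "\<bar>g x * h x\<bar> \<le> (C * exp (a / 2 * (norm x)\<^sup>2)) * (D * exp (a / 2 * (norm x)\<^sup>2))"
      unfolding abs_mult using C(1) by (intro mult_mono C D) auto
    also have "\<dots> = (C * D) * exp (a * (norm x)\<^sup>2)"
      by (simp add: exp_add[symmetric] algebra_simps)
    finally show ?thesis .
  qed
  then show "\<exists>C. \<forall>x. \<bar>g x * h x\<bar> \<le> C * exp (a * (norm x)\<^sup>2)" by blast
qed

lemma subgaussian_growth_uminus: "subgaussian_growth g \<Longrightarrow> subgaussian_growth (\<lambda>x. - g x)"
  unfolding subgaussian_growth_def by simp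

lemma subgaussian_growth_diff:
  "subgaussian_growth g \<Longrightarrow> subgaussian_growth h \<Longrightarrow> subgaussian_growth (\<lambda>x. g x - h x)"
  using subgaussian_growth_add[OF _ subgaussian_growth_uminus, of g h] by simp

lemma subgaussian_growth_power:
  "subgaussian_growth g \<Longrightarrow> subgaussian_growth (\<lambda>x. g x ^ k)"
  by (induction k) (simp_all add: subgaussian_growth_const subgaussian_growth_mult)

lemma subgaussian_growth_sum:
  "(\<And>i. i \<in> I \<Longrightarrow> subgaussian_growth (g i)) \<Longrightarrow> subgaussian_growth (\<lambda>x. \<Sum>i\<in>I. g i x)"
  by (induction I rule: infinite_finite_induct)
    (simp_all add: subgaussian_growth_const subgaussian_growth_add)

text \<open>The exponent is arbitrary, so the operator bound \<open>K\<close> is absorbed by using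
  the growth of \<open>g\<close> with exponent \<open>a / K\<^sup>2\<close>.\<close>

lemma subgaussian_growth_bounded_linear:
  assumes L: "bounded_linear L" and g: "subgaussian_growth g"
  shows "subgaussian_growth (\<lambda>x. g (L x))"
  unfolding subgaussian_growth_def
proof (intro allI impI)
  fix a :: real assume a: "a > 0"
  obtain K where K: "K > 0" "\<And>x. norm (L x) \<le> norm x * K"
    using bounded_linear.pos_bounded[OF L] by blast
  obtain C where C: "C > 0" "\<And>x. \<bar>g x\<bar> \<le> C * exp (a / K\<^sup>2 * (norm x)\<^sup>2)"
    using subgaussian_growthE[OF g, of "a / K\<^sup>2"] a K by auto
  have "\<bar>g (L x)\<bar> \<le> C * exp (a * (norm x)\<^sup>2)" for x
  proof -
    have "(norm (L x))\<^sup>2 \<le> (norm x * K)\<^sup>2" by (intro power_mono K) auto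
    then have "a / K\<^sup>2 * (norm (L x))\<^sup>2 \<le> a / K\<^sup>2 * (norm x * K)\<^sup>2"
      using a by (intro mult_left_mono) auto
    also have "\<dots> = a * (norm x)\<^sup>2" using K by (simp add: power_mult_distrib)
    finally show ?thesis
      using C by (intro order_trans[OF C(2)] mult_left_mono) auto
  qed
  then show "\<exists>C. \<forall>x. \<bar>g (L x)\<bar> \<le> C * exp (a * (norm x)\<^sup>2)" by blast
qed

lemma subgaussian_growth_norm: "subgaussian_growth (norm :: 'b::real_normed_vector \<Rightarrow> real)"
  unfolding subgaussian_growth_def
proof (intro allI impI exI)
  fix a :: real and x :: 'b assume a: "a > 0"
  \<comment> \<open>Completing the square is where the constant 1/(4a) comes from.\<close>
  have "0 \<le> (2 * a * norm x - 1)\<^sup>2" by simp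
  then have "4 * a * norm x \<le> 4 * a * (a * (norm x)\<^sup>2) + 1"
    by (simp add: power2_eq_square algebra_simps)
  then have "norm x \<le> a * (norm x)\<^sup>2 + 1 / (4 * a)"
    using a by (simp add: field_simps)
  also have "\<dots> \<le> (1 + 1 / (4 * a)) * (1 + a * (norm x)\<^sup>2)"
    using a by (simp add: algebra_simps)
  also have "\<dots> \<le> (1 + 1 / (4 * a)) * exp (a * (norm x)\<^sup>2)"
    using a by (intro mult_left_mono) auto
  finally show "\<bar>norm x\<bar> \<le> (1 + 1 / (4 * a)) * exp (a * (norm x)\<^sup>2)" by simp
qed

lemma subgaussian_growth_mono:
  "subgaussian_growth h \<Longrightarrow> (\<And>x. \<bar>g x\<bar> \<le> \<bar>h x\<bar>) \<Longrightarrow> subgaussian_growth g"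
  unfolding subgaussian_growth_def by (meson order_trans)

lemma subgaussian_growth_linear:
  assumes "bounded_linear (g :: 'b::real_normed_vector \<Rightarrow> real)"
  shows "subgaussian_growth g"
  using subgaussian_growth_bounded_linear[OF assms subgaussian_growth_norm]
  by (rule subgaussian_growth_mono) simp

lemmas subgaussian_growth_intros =
  subgaussian_growth_const subgaussian_growth_add subgaussian_growth_mult
  subgaussian_growth_diff subgaussian_growth_power subgaussian_growth_sum
  subgaussian_growth_uminus

text \<open>Outside a large ball the limit makes \<open>g\<close> smaller than the exponential; on
  the ball continuity and compactness bound it by a constant.\<close>

lemma moderate_growth_imp_subgaussian:
  fixes g :: "real ^ 'n \<Rightarrow> real"
  assumes "moderate_growth g" and cont: "continuous_on UNIV g"
  shows "subgaussian_growth g"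
  unfolding subgaussian_growth_def
proof (intro allI impI)
  fix a :: real assume "a > 0"
  then have "((\<lambda>x. g x * exp (- a * (norm x)\<^sup>2)) \<longlongrightarrow> 0) at_infinity"
    using assms by (simp add: moderate_growth_def)
  then have "eventually (\<lambda>x. norm (g x * exp (- a * (norm x)\<^sup>2)) < 1) at_infinity"
    by (auto dest!: tendstoD[of _ _ _ 1])
  then obtain B where B: "\<And>x. norm x \<ge> B \<Longrightarrow> norm (g x * exp (- a * (norm x)\<^sup>2)) < 1"
    by (auto simp: eventually_at_infinity)
  have "compact (g ` cball 0 B)"
    by (intro compact_continuous_image continuous_on_subset[OF cont]) auto
  then obtain D where D: "\<And>x. norm x \<le> B \<Longrightarrow> \<bar>g x\<bar> \<le> D"
    using compact_imp_bounded[of "g ` cball 0 B"] unfolding bounded_iff by force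
  have "\<bar>g x\<bar> \<le> (1 + \<bar>D\<bar>) * exp (a * (norm x)\<^sup>2)" for x
  proof (cases "norm x \<le> B")
    case True
    have "\<bar>g x\<bar> \<le> (1 + \<bar>D\<bar>) * 1" using D[OF True] by simp
    also have "\<dots> \<le> (1 + \<bar>D\<bar>) * exp (a * (norm x)\<^sup>2)"
      using \<open>a > 0\<close> by (intro mult_left_mono) auto
    finally show ?thesis .
  next
    case False
    then have "\<bar>g x\<bar> * exp (- a * (norm x)\<^sup>2) < 1" using B[of x] by (simp add: abs_mult)
    then have "\<bar>g x\<bar> < 1 * exp (a * (norm x)\<^sup>2)"
      by (simp add: exp_minus field_simps)
    also have "\<dots> \<le> (1 + \<bar>D\<bar>) * exp (a * (norm x)\<^sup>2)" by (intro mult_right_mono) auto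
    finally show ?thesis by simp
  qed
  then show "\<exists>C. \<forall>x. \<bar>g x\<bar> \<le> C * exp (a * (norm x)\<^sup>2)" by blast
qed

text \<open>Centered Gaussian vectors; \<open>\<sigma> = 0\<close> covers degenerate directions.\<close>

definition gaussian0 :: "'a measure \<Rightarrow> ('a \<Rightarrow> 'b::euclidean_space) \<Rightarrow> bool" where
  "gaussian0 M Z \<longleftrightarrow> Z \<in> borel_measurable M \<and>
     (\<forall>a. \<exists>\<sigma>\<ge>0. distr M borel (\<lambda>\<omega>. a \<bullet> Z \<omega>) = distr std_normal_distribution borel (\<lambda>x. \<sigma> * x))"

section \<open>Gaussian laws: exponential integrability, moments and characteristic
  functions\<close>

lemma prob_space_std_normal: "prob_space std_normal_distribution"
  using real_dist_normal_dist by (simp add: real_distribution_def)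

lemma gaussian0_measurable: "gaussian0 M Z \<Longrightarrow> Z \<in> borel_measurable M"
  by (simp add: gaussian0_def)

lemma distr_eq_integrable_iff:
  fixes h :: "'c::topological_space \<Rightarrow> 'e::{banach, second_countable_topology}"
  assumes "distr M borel f = distr N borel g" "f \<in> borel_measurable M" "g \<in> borel_measurable N"
    "h \<in> borel_measurable borel"
  shows "integrable M (\<lambda>x. h (f x)) \<longleftrightarrow> integrable N (\<lambda>x. h (g x))"
  using assms integrable_distr_eq[of f M borel h] integrable_distr_eq[of g N borel h] by simp

lemma distr_eq_integral_eq:
  fixes h :: "'c::topological_space \<Rightarrow> 'e::{banach, second_countable_topology}"
  assumes "distr M borel f = distr N borel g" "f \<in> borel_measurable M" "g \<in> borel_measurable N"
    "h \<in> borel_measurable borel"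
  shows "(\<integral>x. h (f x) \<partial>M) = (\<integral>x. h (g x) \<partial>N)"
  using assms integral_distr[of f M borel h] integral_distr[of g N borel h] by simp

text \<open>Multiplying the standard normal density by exp(a x^2) gives, up to a constant factor,
  the normal density of variance 1/(1 - 2a).\<close>

lemma integrable_std_normal_exp_square:
  assumes "a < 1 / 2"
  shows "integrable std_normal_distribution (\<lambda>x. exp (a * x\<^sup>2))"
proof -
  define s where "s = 1 / sqrt (1 - 2 * a)"
  have s: "s > 0" "s\<^sup>2 = 1 / (1 - 2 * a)" using assms by (auto simp: s_def power_divide)
  have eq: "std_normal_density x * exp (a * x\<^sup>2) = s * normal_density 0 s x" for x
  proof -
    have "- x\<^sup>2 / 2 + a * x\<^sup>2 = - x\<^sup>2 / (2 * s\<^sup>2)"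
      using assms by (simp add: s(2) field_simps)
    then show ?thesis
      using s(1) by (simp add: normal_density_def exp_add[symmetric] real_sqrt_mult field_simps)
  qed
  have "integrable lborel (\<lambda>x. std_normal_density x * exp (a * x\<^sup>2))"
    unfolding eq using s(1) by (intro integrable_mult_right) auto
  then show ?thesis by (subst integrable_density) auto
qed

text \<open>The squared norm is at most the dimension times the largest squared coordinate, so its
  exponential is bounded by a sum of one-dimensional exponentials. This handles the joint law
  although the coordinates may be dependent.\<close>

lemma gaussian0_integrable_exp_norm_square:
  fixes Z :: "'a \<Rightarrow> 'b::euclidean_space"
  assumes Z: "gaussian0 M Z"
  obtains a where "a > 0" "integrable M (\<lambda>\<omega>. exp (a * (norm (Z \<omega>))\<^sup>2))"
proof -
  have [measurable]: "Z \<in> borel_measurable M" using Z by (rule gaussian0_measurable)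
  obtain v where v: "\<And>b. distr M borel (\<lambda>\<omega>. b \<bullet> Z \<omega>) = distr std_normal_distribution borel (\<lambda>x. v b * x)"
    using Z unfolding gaussian0_def by metis
  define S where "S = 1 + (\<Sum>b\<in>(Basis::'b set). (v b)\<^sup>2)"
  \<comment> \<open>This makes \<open>a * DIM('b) * (v b)\<^sup>2\<close> at most 1/4, below the
    threshold 1/2 of the one-dimensional lemma; the summand 1 in \<open>S\<close> keeps it positive
    when all variances vanish.\<close>
  define a where "a = 1 / (4 * real DIM('b) * S)"
  have S: "S \<ge> 1" by (auto simp: S_def intro: sum_nonneg)
  have a: "a > 0" using S by (auto simp: a_def)
  have int: "integrable M (\<lambda>\<omega>. exp (a * DIM('b) * (b \<bullet> Z \<omega>)\<^sup>2))" if b: "b \<in> Basis" for b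
  proof -
    have "(v b)\<^sup>2 \<le> S"
      unfolding S_def using member_le_sum[OF b, of "\<lambda>b. (v b)\<^sup>2"] by simp
    then have "(v b)\<^sup>2 * (1 / (4 * S)) \<le> S * (1 / (4 * S))"
      using S by (intro mult_right_mono) auto
    then have "a * DIM('b) * (v b)\<^sup>2 < 1 / 2"
      using S by (simp add: a_def field_simps)
    from integrable_std_normal_exp_square[OF this]
    have "integrable std_normal_distribution (\<lambda>x. exp (a * DIM('b) * (v b * x)\<^sup>2))"
      by (simp add: power_mult_distrib mult_ac)
    then show ?thesis
      using distr_eq_integrable_iff[OF v, where h="\<lambda>z. exp (a * DIM('b) * z\<^sup>2)"] by simp
  qed
  have "exp (a * (norm z)\<^sup>2) \<le> (\<Sum>b\<in>Basis. exp (a * DIM('b) * (b \<bullet> z)\<^sup>2))" for z :: 'b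
  proof -
    define m where "m = Max ((\<lambda>b. (b \<bullet> z)\<^sup>2) ` Basis)"
    have "m \<in> (\<lambda>b. (b \<bullet> z)\<^sup>2) ` Basis" unfolding m_def by (rule Max_in) auto
    then obtain b0 where b0: "b0 \<in> Basis" "m = (b0 \<bullet> z)\<^sup>2" by auto
    have "(norm z)\<^sup>2 = (\<Sum>b\<in>Basis. (b \<bullet> z)\<^sup>2)"
      by (subst power2_norm_eq_inner, subst euclidean_inner)
        (simp add: power2_eq_square inner_commute)
    also have "\<dots> \<le> (\<Sum>b\<in>(Basis::'b set). m)"
      by (rule sum_mono) (auto simp: m_def intro: Max_ge)
    finally have "a * (norm z)\<^sup>2 \<le> a * DIM('b) * (b0 \<bullet> z)\<^sup>2"
      using a by (simp add: b0 mult.assoc)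
    then have "exp (a * (norm z)\<^sup>2) \<le> exp (a * DIM('b) * (b0 \<bullet> z)\<^sup>2)" by simp
    also have "\<dots> \<le> (\<Sum>b\<in>Basis. exp (a * DIM('b) * (b \<bullet> z)\<^sup>2))"
      using b0 by (intro member_le_sum) auto
    finally show ?thesis .
  qed
  then have "integrable M (\<lambda>\<omega>. exp (a * (norm (Z \<omega>))\<^sup>2))"
    by (intro Bochner_Integration.integrable_bound[OF Bochner_Integration.integrable_sum[OF int]])
      (auto intro!: AE_I2 order_trans[OF _ abs_ge_self])
  with a that show ?thesis by blast
qed

text \<open>The growth bound is available for every exponent, in particular for the small one at
  which the Gaussian vector has an exponential square moment.\<close>

lemma gaussian0_integrable_subgaussian:
  assumes Z: "gaussian0 M Z" and g: "subgaussian_growth g" and "g \<in> borel_measurable borel"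
  shows "integrable M (\<lambda>\<omega>. g (Z \<omega>))"
proof -
  note [measurable] = gaussian0_measurable[OF Z] assms(3)
  obtain a where a: "a > 0" "integrable M (\<lambda>\<omega>. exp (a * (norm (Z \<omega>))\<^sup>2))"
    using gaussian0_integrable_exp_norm_square[OF Z] by blast
  obtain C where "\<And>x. \<bar>g x\<bar> \<le> C * exp (a * (norm x)\<^sup>2)"
    using g a(1) unfolding subgaussian_growth_def by blast
  then show ?thesis
    by (intro Bochner_Integration.integrable_bound[OF integrable_mult_right[OF a(2), of C]])
      (auto intro!: AE_I2 order_trans[OF _ abs_ge_self])
qed

lemma gaussian0_integrable_continuous:
  assumes "gaussian0 M Z" "subgaussian_growth g" "continuous_on UNIV g"
  shows "integrable M (\<lambda>\<omega>. g (Z \<omega>))"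
  using assms by (intro gaussian0_integrable_subgaussian borel_measurable_continuous_onI)

text \<open>The unspecified deviation in \<open>gaussian0\<close> is recovered from the second
  moment, so the law of each projection is determined by its variance.\<close>

lemma gaussian0_second_moment:
  assumes Z: "gaussian0 M Z"
  shows "distr M borel (\<lambda>\<omega>. a \<bullet> Z \<omega>) =
    distr std_normal_distribution borel (\<lambda>x. sqrt (\<integral>\<omega>. (a \<bullet> Z \<omega>)\<^sup>2 \<partial>M) * x)"
    and "(\<integral>\<omega>. a \<bullet> Z \<omega> \<partial>M) = 0"
proof -
  note [measurable] = gaussian0_measurable[OF Z]
  obtain v where v0: "v \<ge> 0" and v: "distr M borel (\<lambda>\<omega>. a \<bullet> Z \<omega>) = distr std_normal_distribution borel (\<lambda>x. v * x)"
    using Z unfolding gaussian0_def by blast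
  have "(\<integral>\<omega>. (a \<bullet> Z \<omega>)\<^sup>2 \<partial>M) = (\<integral>x. (v * x)\<^sup>2 \<partial>std_normal_distribution)"
    by (rule distr_eq_integral_eq[OF v]) auto
  also have "\<dots> = v\<^sup>2 * (\<integral>x. x ^ (2 * 1) \<partial>std_normal_distribution)"
    by (simp add: power_mult_distrib)
  also have "\<dots> = v\<^sup>2"
    unfolding std_normal_distribution_even_moments(1) by simp
  finally have v2: "(\<integral>\<omega>. (a \<bullet> Z \<omega>)\<^sup>2 \<partial>M) = v\<^sup>2" .
  show "distr M borel (\<lambda>\<omega>. a \<bullet> Z \<omega>) =
    distr std_normal_distribution borel (\<lambda>x. sqrt (\<integral>\<omega>. (a \<bullet> Z \<omega>)\<^sup>2 \<partial>M) * x)"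
    using v v0 by (simp add: v2)
  have "(\<integral>\<omega>. a \<bullet> Z \<omega> \<partial>M) = (\<integral>x. v * x \<partial>std_normal_distribution)"
    by (rule distr_eq_integral_eq[OF v, where h="\<lambda>x. x"]) auto
  also have "\<dots> = 0"
    using integral_std_normal_distribution_moment_odd[of 1] by simp
  finally show "(\<integral>\<omega>. a \<bullet> Z \<omega> \<partial>M) = 0" .
qed

lemma gaussian0_char:
  assumes Z: "gaussian0 M Z"
  shows "(CLINT \<omega>|M. iexp (a \<bullet> Z \<omega>)) = exp (- (\<integral>\<omega>. (a \<bullet> Z \<omega>)\<^sup>2 \<partial>M) / 2)"
proof -
  note [measurable] = gaussian0_measurable[OF Z]
  let ?v = "\<integral>\<omega>. (a \<bullet> Z \<omega>)\<^sup>2 \<partial>M"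
  have "(CLINT \<omega>|M. iexp (a \<bullet> Z \<omega>)) = (CLINT x|std_normal_distribution. iexp (sqrt ?v * x))"
    by (rule distr_eq_integral_eq[OF gaussian0_second_moment(1)[OF Z], where h=iexp]) auto
  also have "\<dots> = char std_normal_distribution (sqrt ?v)" by (simp add: char_def)
  also have "\<dots> = exp (- ?v / 2)"
    by (simp add: char_std_normal_distribution)
  finally show ?thesis .
qed

text \<open>One-dimensional Levy uniqueness is applied to each projection; \<open>v\<close> may
  depend on the direction \<open>a\<close> but not on \<open>s\<close>.\<close>

lemma gaussian0I_char:
  assumes "prob_space M" and [measurable]: "Z \<in> borel_measurable M"
    and char: "\<And>a. \<exists>v\<ge>0. \<forall>s. (CLINT \<omega>|M. iexp (s * (a \<bullet> Z \<omega>))) = exp (- s\<^sup>2 * v / 2)"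
  shows "gaussian0 M Z"
  unfolding gaussian0_def
proof (intro conjI allI)
  interpret prob_space M by fact
  interpret std: prob_space std_normal_distribution by (rule prob_space_std_normal)
  fix a
  obtain v where v: "v \<ge> 0" "\<And>s. (CLINT \<omega>|M. iexp (s * (a \<bullet> Z \<omega>))) = exp (- s\<^sup>2 * v / 2)"
    using char by metis
  have "distr M borel (\<lambda>\<omega>. a \<bullet> Z \<omega>) = distr std_normal_distribution borel (\<lambda>x. sqrt v * x)"
  proof (rule Levy_uniqueness)
    show "real_distribution (distr M borel (\<lambda>\<omega>. a \<bullet> Z \<omega>))"
      by (rule real_distribution_distr) auto
    show "real_distribution (distr std_normal_distribution borel (\<lambda>x. sqrt v * x))"
      by (rule std.real_distribution_distr) auto
    show "char (distr M borel (\<lambda>\<omega>. a \<bullet> Z \<omega>)) = char (distr std_normal_distribution borel (\<lambda>x. sqrt v * x))"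
    proof
      fix s
      have "char (distr std_normal_distribution borel (\<lambda>x. sqrt v * x)) s
        = char std_normal_distribution (s * sqrt v)"
        by (simp add: char_def integral_distr mult_ac)
      then show "char (distr M borel (\<lambda>\<omega>. a \<bullet> Z \<omega>)) s = char (distr std_normal_distribution borel (\<lambda>x. sqrt v * x)) s"
        using v by (simp add: char_def integral_distr char_std_normal_distribution power_mult_distrib)
    qed
  qed
  then show "\<exists>\<sigma>\<ge>0. distr M borel (\<lambda>\<omega>. a \<bullet> Z \<omega>) = distr std_normal_distribution borel (\<lambda>x. \<sigma> * x)"
    using v(1) real_sqrt_ge_zero by blast
qed fact

section \<open>Characteristic functions determine measures on Euclidean spaces\<close>

text \<open>A standard Gaussian vector is encoded by its independent coordinates \<open>W\<close>;
  the vector itself is the sum of \<open>W b *\<^sub>R b\<close> over the basis.\<close>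

abbreviation std_normal_family :: "('b::euclidean_space \<Rightarrow> real) measure" where
  "std_normal_family \<equiv> PiM Basis (\<lambda>_. std_normal_distribution)"

interpretation std_normal: prob_space std_normal_distribution
  by (rule prob_space_std_normal)

interpretation std_normal_family: product_prob_space "\<lambda>_::'b::euclidean_space. std_normal_distribution" Basis
  by standard

text \<open>The standard Gaussian density, in product form so that product-measure formulas apply
  coordinatewise.\<close>

definition gauss_kernel :: "'b::euclidean_space \<Rightarrow> real" where
  "gauss_kernel z = (\<Prod>b\<in>Basis. std_normal_density (z \<bullet> b))"

lemma gauss_kernel_nonneg: "gauss_kernel z \<ge> 0"
  by (simp add: gauss_kernel_def prod_nonneg)

lemma borel_measurable_gauss_kernel [measurable]: "gauss_kernel \<in> borel_measurable borel"
  unfolding gauss_kernel_def[abs_def] by measurable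

lemma nn_integral_gauss_kernel: "(\<integral>\<^sup>+z. gauss_kernel (z::'b::euclidean_space) \<partial>lborel) = 1"
proof -
  have "(\<integral>\<^sup>+x. std_normal_density x \<partial>lborel) = 1"
    by (subst nn_integral_eq_integral) auto
  moreover have "(\<integral>\<^sup>+z. gauss_kernel (z::'b) \<partial>lborel) = (\<Prod>b\<in>(Basis::'b set). \<integral>\<^sup>+x. std_normal_density x \<partial>lborel)"
    by (subst nn_integral_lborel_prod[symmetric]) (auto simp: gauss_kernel_def prod_ennreal)
  ultimately show ?thesis by simp
qed

text \<open>The Gaussian density is an average of characters, because the Gaussian law is its own characteristic
  function up to a constant.\<close>

lemma gauss_kernel_eq_char:
  "complex_of_real (gauss_kernel z) = (1 / sqrt (2 * pi)) ^ DIM('b) *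
     (CLINT W|std_normal_family. iexp ((\<Sum>b\<in>Basis. W b *\<^sub>R b) \<bullet> (z::'b::euclidean_space)))"
proof -
  have "(CLINT W|std_normal_family. iexp ((\<Sum>b\<in>Basis. W b *\<^sub>R b) \<bullet> z))
    = (CLINT W|std_normal_family. (\<Prod>b\<in>Basis. iexp ((z \<bullet> b) * W b)))"
    by (simp add: inner_sum_left inner_sum_right exp_sum[symmetric] sum_distrib_left inner_commute mult_ac)
  also have "\<dots> = (\<Prod>b\<in>Basis. CLINT x|std_normal_distribution. iexp ((z \<bullet> b) * x))"
    by (intro std_normal_family.product_integral_prod finite_Basis std_normal.integrable_const_bound[where B=1])
      auto
  also have "\<dots> = (\<Prod>b\<in>Basis. complex_of_real (exp (- ((z \<bullet> b)\<^sup>2) / 2)))"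
    using char_std_normal_distribution by (intro prod.cong refl) (simp add: char_def fun_eq_iff)
  finally show ?thesis
    by (simp add: gauss_kernel_def std_normal_density_def prod.distrib power_divide prod_dividef)
qed

text \<open>Fubini moves the average over \<open>W\<close> outside, after which \<open>\<mu>\<close>
  enters only through its characteristic function.\<close>

lemma integral_gauss_kernel_eq_char:
  assumes "prob_space \<mu>" and [measurable_cong]: "sets \<mu> = sets (borel :: 'b::euclidean_space measure)"
  shows "complex_of_real (\<integral>x. gauss_kernel (s *\<^sub>R (y - x)) \<partial>\<mu>) =
    (1 / sqrt (2 * pi)) ^ DIM('b) *
    (CLINT W|std_normal_family. iexp (s * ((\<Sum>b\<in>Basis. W b *\<^sub>R b) \<bullet> y)) *
      (CLINT x|\<mu>. iexp (- s *\<^sub>R (\<Sum>b\<in>Basis. W b *\<^sub>R b) \<bullet> x)))"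
proof -
  interpret mu: prob_space \<mu> by fact
  interpret P: pair_prob_space \<mu> "std_normal_family :: ('b \<Rightarrow> real) measure" ..
  have "complex_of_real (\<integral>x. gauss_kernel (s *\<^sub>R (y - x)) \<partial>\<mu>)
    = (CLINT x|\<mu>. complex_of_real (gauss_kernel (s *\<^sub>R (y - x))))" by simp
  also have "\<dots> = (1 / sqrt (2 * pi)) ^ DIM('b) * (CLINT x|\<mu>. (CLINT W|std_normal_family.
      iexp ((\<Sum>b\<in>Basis. W b *\<^sub>R b) \<bullet> (s *\<^sub>R (y - x)))))"
    unfolding gauss_kernel_eq_char by simp
  also have "(CLINT x|\<mu>. (CLINT W|std_normal_family. iexp ((\<Sum>b\<in>Basis. W b *\<^sub>R b) \<bullet> (s *\<^sub>R (y - x)))))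
    = (CLINT W|std_normal_family. (CLINT x|\<mu>. iexp ((\<Sum>b\<in>Basis. W b *\<^sub>R b) \<bullet> (s *\<^sub>R (y - x)))))"
    by (intro P.Fubini_integral[symmetric] P.P.integrable_const_bound[where B=1]) auto
  also have "\<dots> = (CLINT W|std_normal_family. iexp (s * ((\<Sum>b\<in>Basis. W b *\<^sub>R b) \<bullet> y)) *
      (CLINT x|\<mu>. iexp (- s *\<^sub>R (\<Sum>b\<in>Basis. W b *\<^sub>R b) \<bullet> x)))"
    by (simp add: inner_diff_right right_diff_distrib exp_diff exp_minus divide_inverse flip: integral_mult_right_zero)
  finally show ?thesis .
qed

text \<open>The kernel is nonnegative and bounded, so the complex identity above transfers to
  nonnegative integrals.\<close>

lemma nn_integral_gauss_kernel_cong: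
  assumes "prob_space \<mu>" "sets \<mu> = sets (borel :: 'b::euclidean_space measure)"
    and "prob_space \<nu>" "sets \<nu> = sets (borel :: 'b::euclidean_space measure)"
    and char: "\<And>a. (CLINT x|\<mu>. iexp (a \<bullet> x)) = (CLINT x|\<nu>. iexp (a \<bullet> x))"
  shows "(\<integral>\<^sup>+x. gauss_kernel (s *\<^sub>R (y - x)) \<partial>\<mu>) = (\<integral>\<^sup>+x. gauss_kernel (s *\<^sub>R (y - x)) \<partial>\<nu>)"
proof -
  have le: "gauss_kernel z \<le> (1 / sqrt (2 * pi)) ^ DIM('b)" for z :: 'b
  proof -
    have "gauss_kernel z \<le> (\<Prod>b\<in>(Basis::'b set). 1 / sqrt (2 * pi))"
      unfolding gauss_kernel_def
      by (intro prod_mono) (auto simp: std_normal_density_def divide_right_mono)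
    then show ?thesis by simp
  qed
  have eq: "(\<integral>\<^sup>+x. gauss_kernel (s *\<^sub>R (y - x)) \<partial>\<mu>) = ennreal (\<integral>x. gauss_kernel (s *\<^sub>R (y - x)) \<partial>\<mu>)"
    if "prob_space \<mu>" and [measurable_cong]: "sets \<mu> = sets (borel :: 'b measure)" for \<mu>
  proof -
    interpret prob_space \<mu> by fact
    show ?thesis using le gauss_kernel_nonneg
      by (intro nn_integral_eq_integral integrable_const_bound[where B="(1 / sqrt (2 * pi)) ^ DIM('b)"]) auto
  qed
  have "complex_of_real (\<integral>x. gauss_kernel (s *\<^sub>R (y - x)) \<partial>\<mu>) = complex_of_real (\<integral>x. gauss_kernel (s *\<^sub>R (y - x)) \<partial>\<nu>)"
    using assms by (simp only: integral_gauss_kernel_eq_char char)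
  then show ?thesis using assms eq by simp
qed

section \<open>Gaussian smoothing as an approximate identity\<close>

lemma nn_integral_lborel_affine:
  fixes x :: "'b::euclidean_space"
  assumes [measurable]: "F \<in> borel_measurable borel" and t: "t > 0"
  shows "(\<integral>\<^sup>+y. F y \<partial>lborel) = ennreal (t ^ DIM('b)) * (\<integral>\<^sup>+z. F (x + t *\<^sub>R z) \<partial>lborel)"
proof -
  have "(\<integral>\<^sup>+y. F y \<partial>lborel) = (\<integral>\<^sup>+y. F y \<partial>density (distr lborel borel (\<lambda>z. x + t *\<^sub>R z)) (\<lambda>_. \<bar>t\<bar> ^ DIM('b)))"
    using lborel_affine[of t x] t by simp
  then show ?thesis
    using t by (simp add: nn_integral_density nn_integral_distr nn_integral_cmult)
qed

text \<open>The average is the mean of \<open>h\<close> at \<open>x\<close> plus small Gaussian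
  noise; the kernel itself dominates the integrands.\<close>

lemma tendsto_gauss_average:
  fixes h :: "'b::euclidean_space \<Rightarrow> real"
  assumes cont: "continuous_on UNIV h" and h: "\<And>x. 0 \<le> h x" "\<And>x. h x \<le> 1" 
  shows "(\<lambda>k. \<integral>\<^sup>+z. h (x + inverse (real (Suc k)) *\<^sub>R z) * gauss_kernel z \<partial>lborel) \<longlonglongrightarrow> h x"
proof -
  note [measurable] = borel_measurable_continuous_onI[OF cont]
  have "(\<lambda>k. \<integral>\<^sup>+z. h (x + inverse (real (Suc k)) *\<^sub>R z) * gauss_kernel z \<partial>lborel) \<longlonglongrightarrow>
    (\<integral>\<^sup>+z. ennreal (h x * gauss_kernel (z::'b)) \<partial>lborel)"
  proof (rule nn_integral_dominated_convergence[where w="\<lambda>z. ennreal (gauss_kernel z)"])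
    show "AE z in lborel. ennreal (h (x + inverse (real (Suc j)) *\<^sub>R z) * gauss_kernel z) \<le> gauss_kernel z" for j
      by (intro AE_I2 ennreal_leI mult_left_le_one_le h gauss_kernel_nonneg)
    show "AE z in lborel. (\<lambda>k. ennreal (h (x + inverse (real (Suc k)) *\<^sub>R z) * gauss_kernel z))
      \<longlonglongrightarrow> ennreal (h x * gauss_kernel z)"
    proof (intro AE_I2 tendsto_ennrealI tendsto_intros)
      fix z
      have "(\<lambda>k. x + inverse (real (Suc k)) *\<^sub>R z) \<longlonglongrightarrow> x + 0 *\<^sub>R z"
        by (intro tendsto_intros LIMSEQ_inverse_real_of_nat)
      then have "(\<lambda>k. x + inverse (real (Suc k)) *\<^sub>R z) \<longlonglongrightarrow> x" by simp
      moreover have "isCont h x" using cont by (simp add: continuous_on_eq_continuous_at)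
      ultimately show "(\<lambda>k. h (x + inverse (real (Suc k)) *\<^sub>R z)) \<longlonglongrightarrow> h x"
        by (rule isCont_tendsto_compose[rotated])
    qed
  qed (auto simp: nn_integral_gauss_kernel)
  also have "(\<integral>\<^sup>+z. ennreal (h x * gauss_kernel (z::'b)) \<partial>lborel) = h x"
    using h by (simp add: ennreal_mult' gauss_kernel_nonneg nn_integral_cmult nn_integral_gauss_kernel)
  finally show ?thesis .
qed

text \<open>Substituting y = x + t z and exchanging integrals isolates the part that depends on
  \<open>\<mu>\<close>. The Jacobian is kept as a factor on the left, to be cancelled later.\<close>

lemma nn_integral_gauss_average:
  fixes h :: "'b::euclidean_space \<Rightarrow> real"
  assumes "prob_space \<mu>" and [measurable_cong]: "sets \<mu> = sets (borel :: 'b measure)"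
    and [measurable]: "h \<in> borel_measurable borel" and h: "\<And>x. 0 \<le> h x" and t: "t > 0"
  shows "ennreal (t ^ DIM('b)) * (\<integral>\<^sup>+x. (\<integral>\<^sup>+z. h (x + t *\<^sub>R z) * gauss_kernel z \<partial>lborel) \<partial>\<mu>)
    = (\<integral>\<^sup>+y. h y * (\<integral>\<^sup>+x. gauss_kernel (inverse t *\<^sub>R (y - x)) \<partial>\<mu>) \<partial>lborel)"
proof -
  interpret mu: prob_space \<mu> by fact
  interpret P: pair_sigma_finite \<mu> "lborel :: 'b measure" ..
  have "ennreal (t ^ DIM('b)) * (\<integral>\<^sup>+x. (\<integral>\<^sup>+z. h (x + t *\<^sub>R z) * gauss_kernel z \<partial>lborel) \<partial>\<mu>)
    = (\<integral>\<^sup>+x. ennreal (t ^ DIM('b)) * (\<integral>\<^sup>+z. h (x + t *\<^sub>R z) * gauss_kernel z \<partial>lborel) \<partial>\<mu>)"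
    by (subst nn_integral_cmult) auto
  also have "\<dots> = (\<integral>\<^sup>+x. (\<integral>\<^sup>+y. h y * gauss_kernel (inverse t *\<^sub>R (y - x)) \<partial>lborel) \<partial>\<mu>)"
    using t by (subst nn_integral_lborel_affine[where t=t and F="\<lambda>y. ennreal (h y * gauss_kernel (inverse t *\<^sub>R (y - x)))" and x=x for x]) auto
  also have "\<dots> = (\<integral>\<^sup>+y. (\<integral>\<^sup>+x. h y * gauss_kernel (inverse t *\<^sub>R (y - x)) \<partial>\<mu>) \<partial>lborel)"
    by (rule P.Fubini'[symmetric]) auto
  also have "\<dots> = (\<integral>\<^sup>+y. h y * (\<integral>\<^sup>+x. gauss_kernel (inverse t *\<^sub>R (y - x)) \<partial>\<mu>) \<partial>lborel)"
    using h by (simp add: ennreal_mult' gauss_kernel_nonneg nn_integral_cmult)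
  finally show ?thesis .
qed

lemma tendsto_nn_integral_gauss_average:
  fixes h :: "'b::euclidean_space \<Rightarrow> real"
  assumes "prob_space \<mu>" and [measurable_cong]: "sets \<mu> = sets (borel :: 'b measure)"
    and cont: "continuous_on UNIV h" and h: "\<And>x. 0 \<le> h x" "\<And>x. h x \<le> 1" 
  shows "(\<lambda>k. \<integral>\<^sup>+x. (\<integral>\<^sup>+z. h (x + inverse (real (Suc k)) *\<^sub>R z) * gauss_kernel z \<partial>lborel) \<partial>\<mu>)
    \<longlonglongrightarrow> (\<integral>\<^sup>+x. h x \<partial>\<mu>)"
proof (rule nn_integral_dominated_convergence[where w="\<lambda>_. 1"])
  interpret mu: prob_space \<mu> by fact
  note [measurable] = borel_measurable_continuous_onI[OF cont]
  show "(\<integral>\<^sup>+x. 1 \<partial>\<mu>) < \<infinity>" by (simp add: mu.emeasure_space_1)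
  show "AE x in \<mu>. (\<lambda>k. \<integral>\<^sup>+z. h (x + inverse (real (Suc k)) *\<^sub>R z) * gauss_kernel z \<partial>lborel) \<longlonglongrightarrow> h x"
    using tendsto_gauss_average[OF cont h] by simp
  have "(\<integral>\<^sup>+z. h (x + s *\<^sub>R z) * gauss_kernel z \<partial>lborel) \<le> (\<integral>\<^sup>+z. gauss_kernel (z::'b) \<partial>lborel)" for x s
    by (intro nn_integral_mono ennreal_leI mult_left_le_one_le h gauss_kernel_nonneg)
  then show "AE x in \<mu>. (\<integral>\<^sup>+z. h (x + inverse (real (Suc j)) *\<^sub>R z) * gauss_kernel z \<partial>lborel) \<le> 1" for j
    by (simp add: nn_integral_gauss_kernel)
qed (use borel_measurable_continuous_onI[OF cont] in measurable)

text \<open>The integrals of the kernels \<open>x \<mapsto> G((y - x)/t)\<close> are determined by the characteristic function, and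
  averaging a continuous \<open>h\<close> against them recovers \<open>h\<close> as \<open>t \<rightarrow> 0\<close>.\<close>

theorem char_eq_imp_measure_eq:
  fixes \<mu> \<nu> :: "'b::euclidean_space measure"
  assumes mu: "prob_space \<mu>" "sets \<mu> = sets borel" and nu: "prob_space \<nu>" "sets \<nu> = sets borel"
    and char: "\<And>a. (CLINT x|\<mu>. iexp (a \<bullet> x)) = (CLINT x|\<nu>. iexp (a \<bullet> x))"
  shows "\<mu> = \<nu>"
proof -
  have sm: "space \<mu> = UNIV" "space \<nu> = UNIV"
    using sets_eq_imp_space_eq[OF mu(2)] sets_eq_imp_space_eq[OF nu(2)] by auto
  have cont_eq: "(\<integral>\<^sup>+x. h x \<partial>\<mu>) = (\<integral>\<^sup>+x. h x \<partial>\<nu>)"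
    if cont: "continuous_on UNIV h" and h: "\<And>x. 0 \<le> h x" "\<And>x. h x \<le> 1" for h :: "'b \<Rightarrow> real"
  proof (rule LIMSEQ_unique[OF tendsto_nn_integral_gauss_average[OF mu cont h]])
    have "(\<integral>\<^sup>+x. (\<integral>\<^sup>+z. h (x + t *\<^sub>R z) * gauss_kernel z \<partial>lborel) \<partial>\<mu>) =
       (\<integral>\<^sup>+x. (\<integral>\<^sup>+z. h (x + t *\<^sub>R z) * gauss_kernel z \<partial>lborel) \<partial>\<nu>)" if t: "t > 0" for t
    proof -
      have "ennreal (t ^ DIM('b)) * (\<integral>\<^sup>+x. (\<integral>\<^sup>+z. h (x + t *\<^sub>R z) * gauss_kernel z \<partial>lborel) \<partial>\<mu>) =
       ennreal (t ^ DIM('b)) * (\<integral>\<^sup>+x. (\<integral>\<^sup>+z. h (x + t *\<^sub>R z) * gauss_kernel z \<partial>lborel) \<partial>\<nu>)"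
        by (simp only: nn_integral_gauss_average[OF mu borel_measurable_continuous_onI[OF cont] h(1) t]
            nn_integral_gauss_average[OF nu borel_measurable_continuous_onI[OF cont] h(1) t]
            nn_integral_gauss_kernel_cong[OF mu nu char])
      then show ?thesis using t by (simp add: ennreal_mult_cancel_left)
    qed
    then show "(\<lambda>k. \<integral>\<^sup>+x. (\<integral>\<^sup>+z. h (x + inverse (real (Suc k)) *\<^sub>R z) * gauss_kernel z \<partial>lborel) \<partial>\<mu>)
      \<longlonglongrightarrow> (\<integral>\<^sup>+x. h x \<partial>\<nu>)"
      using tendsto_nn_integral_gauss_average[OF nu cont h] by simp
  qed
  show ?thesis
  \<comment> \<open>Closed sets form an intersection-stable generator of the Borel sets, and their
    indicators are limits of continuous functions with values in [0,1].\<close>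
  proof (rule measure_eqI_generator_eq[where \<Omega>=UNIV and E="Collect closed" and A="\<lambda>_. UNIV"])
    fix C :: "'b set" assume "C \<in> Collect closed"
    then have C: "closed C" by simp
    show "emeasure \<mu> C = emeasure \<nu> C"
    \<comment> \<open>The empty set is separated because \<open>infdist\<close> to it is 0, which
      would make the approximating functions constantly 1.\<close>
    proof (cases "C = {}")
      case False
      define h where "h k x = max 0 (1 - real k * infdist x C)" for k x
      have h: "continuous_on UNIV (h k)" "0 \<le> h k x" "h k x \<le> 1" for k x
        unfolding h_def by (auto intro!: continuous_intros simp: infdist_nonneg)
      have lim: "(\<lambda>k. \<integral>\<^sup>+x. h k x \<partial>\<mu>) \<longlonglongrightarrow> emeasure \<mu> C"
        if "prob_space \<mu>" and [measurable_cong]: "sets \<mu> = sets borel" for \<mu> :: "'b measure"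
      proof -
        interpret prob_space \<mu> by fact
        note [measurable] = borel_measurable_continuous_onI[OF h(1)] borel_closed[OF C]
        have "(\<lambda>k. \<integral>\<^sup>+x. h k x \<partial>\<mu>) \<longlonglongrightarrow> (\<integral>\<^sup>+x. indicator C x \<partial>\<mu>)"
        proof (rule nn_integral_dominated_convergence[where w="\<lambda>_. 1"])
          show "(\<integral>\<^sup>+x. 1 \<partial>\<mu>) < \<infinity>" by (simp add: emeasure_space_1)
          show "AE x in \<mu>. (\<lambda>k. ennreal (h k x)) \<longlonglongrightarrow> indicator C x"
          proof (rule AE_I2)
            fix x
            show "(\<lambda>k. ennreal (h k x)) \<longlonglongrightarrow> indicator C x"
            proof (cases "x \<in> C")
              case True
              then show ?thesis by (simp add: h_def)
            next
              case F: False
              then have pos: "infdist x C > 0"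
                using C False infdist_pos_not_in_closed by blast
              obtain K :: nat where K: "1 < real K * infdist x C"
                using reals_Archimedean3[OF pos] by blast
              have "h k x = 0" if "k \<ge> K" for k
              proof -
                have "real K * infdist x C \<le> real k * infdist x C"
                  using that pos by (intro mult_right_mono) auto
                then show ?thesis using K by (simp add: h_def)
              qed
              then have "eventually (\<lambda>k. ennreal (h k x) = 0) sequentially"
                unfolding eventually_sequentially by (metis ennreal_0)
              then show ?thesis using F by (simp add: tendsto_eventually)
            qed
          qed
        qed (use h in \<open>auto simp: ennreal_le_1\<close>)
        also have "(\<integral>\<^sup>+x. indicator C x \<partial>\<mu>) = emeasure \<mu> C" by simp
        finally show ?thesis .
      qed
      from lim[OF mu] lim[OF nu] show ?thesis
        unfolding cont_eq[OF h] by (rule LIMSEQ_unique)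
    qed simp
  next
    show "Int_stable (Collect closed :: 'b set set)" by (auto simp: Int_stable_def)
    show "sets \<mu> = sigma_sets UNIV (Collect closed)" "sets \<nu> = sigma_sets UNIV (Collect closed)"
      using mu(2) nu(2) by (simp_all add: borel_eq_closed)
    show "emeasure \<mu> UNIV \<noteq> \<infinity>"
      using prob_space.emeasure_space_1[OF mu(1)] sm by simp
  qed auto
qed

section \<open>Gaussian integration by parts\<close>

text \<open>Since |x + r|^2 is at most 2|x|^2 + 2|r|^2, halving the exponent compensates for the
  shift, and the term in \<open>r\<close> goes into the constant.\<close>

lemma subgaussian_growth_shift:
  assumes g: "subgaussian_growth g"
  shows "subgaussian_growth (\<lambda>x. g (x + r))"
  unfolding subgaussian_growth_def
proof (intro allI impI)
  fix a :: real assume a: "a > 0"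
  obtain C where C: "C > 0" "\<And>x. \<bar>g x\<bar> \<le> C * exp (a / 2 * (norm x)\<^sup>2)"
    using subgaussian_growthE[OF g, of "a / 2"] a by auto
  have "\<bar>g (x + r)\<bar> \<le> (C * exp (a * (norm r)\<^sup>2)) * exp (a * (norm x)\<^sup>2)" for x
  proof -
    have "(norm (x + r))\<^sup>2 \<le> (norm x + norm r)\<^sup>2" by (intro power_mono norm_triangle_ineq) auto
    also have "\<dots> \<le> 2 * (norm x)\<^sup>2 + 2 * (norm r)\<^sup>2"
      using sum_squares_bound[of "norm x" "norm r"] by (simp add: power2_sum)
    finally have "a / 2 * (norm (x + r))\<^sup>2 \<le> a / 2 * (2 * (norm x)\<^sup>2 + 2 * (norm r)\<^sup>2)"
      using a by (intro mult_left_mono) auto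
    then have "a / 2 * (norm (x + r))\<^sup>2 \<le> a * (norm r)\<^sup>2 + a * (norm x)\<^sup>2"
      by (simp add: algebra_simps)
    then have "C * exp (a / 2 * (norm (x + r))\<^sup>2) \<le> C * exp (a * (norm r)\<^sup>2 + a * (norm x)\<^sup>2)"
      using C(1) by (intro mult_left_mono) auto
    then show ?thesis
      using C(2)[of "x + r"] by (simp add: exp_add mult.assoc)
  qed
  then show "\<exists>C. \<forall>x. \<bar>g (x + r)\<bar> \<le> C * exp (a * (norm x)\<^sup>2)" by blast
qed

lemma subgaussian_growth_linear_functionals:
  "subgaussian_growth (\<lambda>x::real. x)"
  "subgaussian_growth (\<lambda>z::real \<times> 'b::euclidean_space. fst z)"
  "subgaussian_growth (\<lambda>z::real \<times> 'b::euclidean_space. a \<bullet> snd z)"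
  "subgaussian_growth (\<lambda>z::real \<times> 'b::euclidean_space. snd z \<bullet> a)"
  by (rule subgaussian_growth_linear, auto intro!: bounded_linear_intros)+

text \<open>A projection of the image is a projection of \<open>Z\<close> in the direction given by
  the adjoint.\<close>

lemma gaussian0_linear_image:
  fixes L :: "'b::euclidean_space \<Rightarrow> 'c::euclidean_space"
  assumes Z: "gaussian0 M Z" and L: "bounded_linear L"
  shows "gaussian0 M (\<lambda>\<omega>. L (Z \<omega>))"
proof -
  note [measurable] = gaussian0_measurable[OF Z]
    borel_measurable_continuous_onI[OF bounded_linear.continuous_on[OF L continuous_on_id]]
  have "a \<bullet> L z = adjoint L a \<bullet> z" for a z
    using adjoint_works[OF bounded_linear.linear[OF L], of z a] by (simp add: inner_commute)
  then show ?thesis using Z unfolding gaussian0_def by auto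
qed

lemma gaussian0_char_scaled:
  assumes Z: "gaussian0 M Z"
  shows "(CLINT \<omega>|M. iexp (s * (a \<bullet> Z \<omega>))) = exp (- s\<^sup>2 * (\<integral>\<omega>. (a \<bullet> Z \<omega>)\<^sup>2 \<partial>M) / 2)"
  using gaussian0_char[OF Z, of "s *\<^sub>R a"] by (simp add: power_mult_distrib)

lemma gaussian0_std_normal: "gaussian0 std_normal_distribution (\<lambda>x. x)"
proof (rule gaussian0I_char[OF prob_space_std_normal])
  fix a :: real
  have "(CLINT x|std_normal_distribution. iexp (s * (a \<bullet> x))) = exp (- s\<^sup>2 * a\<^sup>2 / 2)" for s
    using fun_cong[OF char_std_normal_distribution, of "s * a"]
    by (simp add: char_def power_mult_distrib mult_ac)
  then show "\<exists>v\<ge>0. \<forall>s. (CLINT x|std_normal_distribution. iexp (s * (a \<bullet> x))) = exp (- s\<^sup>2 * v / 2)"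
    by (intro exI[of _ "a\<^sup>2"]) auto
qed auto

lemma (in pair_prob_space) integral_bounded_product:
  fixes f g :: "_ \<Rightarrow> complex"
  assumes [measurable]: "f \<in> borel_measurable M1" "g \<in> borel_measurable M2"
    and "\<And>x. norm (f x) \<le> 1" "\<And>y. norm (g y) \<le> 1"
  shows "(CLINT z|M1 \<Otimes>\<^sub>M M2. f (fst z) * g (snd z)) = (CLINT x|M1. f x) * (CLINT y|M2. g y)"
proof -
  have "integrable (M1 \<Otimes>\<^sub>M M2) (\<lambda>z. f (fst z) * g (snd z))"
    using assms(3,4)
    by (intro P.integrable_const_bound[where B=1]) (auto simp: norm_mult intro!: mult_le_one)
  from integral_fst'[OF this] show ?thesis by simp
qed

text \<open>The characteristic function factorizes on the product space, so the variances of the two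
  projections add.\<close>

lemma gaussian0_pair:
  fixes X :: "'a \<Rightarrow> 'b::euclidean_space" and Y :: "'c \<Rightarrow> 'd::euclidean_space"
  assumes "prob_space M" "prob_space N" and X: "gaussian0 M X" and Y: "gaussian0 N Y"
  shows "gaussian0 (M \<Otimes>\<^sub>M N) (\<lambda>z. (X (fst z), Y (snd z)))"
proof -
  interpret M: prob_space M by fact
  interpret N: prob_space N by fact
  interpret P: pair_prob_space M N ..
  note [measurable] = gaussian0_measurable[OF X] gaussian0_measurable[OF Y]
  show ?thesis
  proof (rule gaussian0I_char)
    fix c :: "'b \<times> 'd"
    obtain a b where c: "c = (a, b)" by (cases c)
    have "(CLINT z|M \<Otimes>\<^sub>M N. iexp (s * (c \<bullet> (X (fst z), Y (snd z)))))
      = exp (- s\<^sup>2 * ((\<integral>\<omega>. (a \<bullet> X \<omega>)\<^sup>2 \<partial>M) + (\<integral>\<omega>. (b \<bullet> Y \<omega>)\<^sup>2 \<partial>N)) / 2)" for s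
    proof -
      have "(CLINT z|M \<Otimes>\<^sub>M N. iexp (s * (c \<bullet> (X (fst z), Y (snd z)))))
        = (CLINT z|M \<Otimes>\<^sub>M N. iexp (s * (a \<bullet> X (fst z))) * iexp (s * (b \<bullet> Y (snd z))))"
        by (simp add: c distrib_left exp_add)
      also have "\<dots> = (CLINT \<omega>|M. iexp (s * (a \<bullet> X \<omega>))) * (CLINT \<omega>|N. iexp (s * (b \<bullet> Y \<omega>)))"
        by (rule P.integral_bounded_product) auto
      finally show ?thesis
        unfolding gaussian0_char_scaled[OF X] gaussian0_char_scaled[OF Y]
        by (simp add: exp_add[symmetric] of_real_mult[symmetric] add_divide_distrib algebra_simps del: of_real_mult)
    qed
    then show "\<exists>v\<ge>0. \<forall>s. (CLINT z|M \<Otimes>\<^sub>M N. iexp (s * (c \<bullet> (X (fst z), Y (snd z))))) = exp (- s\<^sup>2 * v / 2)"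
      by (intro exI[of _ "(\<integral>\<omega>. (a \<bullet> X \<omega>)\<^sup>2 \<partial>M) + (\<integral>\<omega>. (b \<bullet> Y \<omega>)\<^sup>2 \<partial>N)"]) auto
  qed (auto intro: P.prob_space_axioms)
qed

text \<open>The derivative of the function times the normal density is the difference of the two
  integrands, and the boundary terms vanish.\<close>

lemma std_normal_integration_by_parts:
  assumes deriv: "\<And>x. (\<psi> has_real_derivative \<psi>' x) (at x)" and cont: "continuous_on UNIV \<psi>'"
    and growth: "subgaussian_growth \<psi>" "subgaussian_growth \<psi>'"
  shows "(\<integral>x. x * \<psi> x \<partial>std_normal_distribution) = (\<integral>x. \<psi>' x \<partial>std_normal_distribution)"
proof -
  let ?\<phi> = std_normal_density
  have cont_\<psi>: "continuous_on UNIV \<psi>"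
    using deriv by (meson DERIV_isCont continuous_at_imp_continuous_on)
  note [measurable] = borel_measurable_continuous_onI[OF cont] borel_measurable_continuous_onI[OF cont_\<psi>]
  have i1: "integrable std_normal_distribution (\<lambda>x. x * \<psi> x)"
    by (rule gaussian0_integrable_continuous[OF gaussian0_std_normal])
      (auto intro!: subgaussian_growth_mult growth continuous_intros cont_\<psi> subgaussian_growth_linear_functionals)
  have i2: "integrable std_normal_distribution \<psi>'"
    by (rule gaussian0_integrable_continuous[OF gaussian0_std_normal growth(2) cont])
  from i1 have j1: "integrable lborel (\<lambda>x. ?\<phi> x * (x * \<psi> x))"
    by (subst (asm) integrable_density) auto
  from i2 have j2: "integrable lborel (\<lambda>x. ?\<phi> x * \<psi>' x)"
    by (subst (asm) integrable_density) auto
  \<comment> \<open>The exponent 1/4 is half that of the density, so the product still decays like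
    exp(-x^2/4).\<close>
  obtain C where C: "C > 0" "\<And>x. \<bar>\<psi> x\<bar> \<le> C * exp (1 / 4 * (norm x)\<^sup>2)"
    using subgaussian_growthE[OF growth(1), of "1 / 4"] by auto
  have bound: "norm (\<psi> x * ?\<phi> x) \<le> C * exp (- x\<^sup>2 / 4)" for x
  proof -
    have "1 \<le> 2 * pi" using pi_gt3 by linarith
    then have phi: "?\<phi> x \<le> 1 * exp (- x\<^sup>2 / 2)"
      unfolding std_normal_density_def by (intro mult_right_mono) auto
    have "norm (\<psi> x * ?\<phi> x) = \<bar>\<psi> x\<bar> * ?\<phi> x" by (simp add: abs_mult)
    also have "\<dots> \<le> (C * exp (1 / 4 * (norm x)\<^sup>2)) * (1 * exp (- x\<^sup>2 / 2))"
      using C by (intro mult_mono phi C(2)) auto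
    also have "\<dots> = C * exp (- x\<^sup>2 / 4)" by (simp add: exp_add[symmetric])
    finally show ?thesis .
  qed
  \<comment> \<open>Stated for a general filter to serve both ends of the real line.\<close>
  have "((\<lambda>x. C * exp (- x\<^sup>2 / 4)) \<longlongrightarrow> 0) F" if "filterlim (\<lambda>x::real. x\<^sup>2) at_top F" for F
  proof -
    have "filterlim (\<lambda>x. 1 / 4 * x\<^sup>2) at_top F"
      by (rule filterlim_tendsto_pos_mult_at_top[OF tendsto_const _ that]) simp
    then have "filterlim (\<lambda>x. - x\<^sup>2 / 4) at_bot F" by (simp add: filterlim_uminus_at_bot)
    then show ?thesis
      by (intro tendsto_mult_right_zero filterlim_compose[OF exp_at_bot])
  qed
  from this[OF filterlim_pow_at_top[OF _ filterlim_ident]] this[OF filterlim_pow_at_bot_even[OF _ filterlim_ident]]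
  have "((\<lambda>x. C * exp (- x\<^sup>2 / 4)) \<longlongrightarrow> 0) at_top" "((\<lambda>x. C * exp (- x\<^sup>2 / 4)) \<longlongrightarrow> 0) at_bot"
    by simp_all
  then have lim: "((\<lambda>x. \<psi> x * ?\<phi> x) \<longlongrightarrow> 0) at_top" "((\<lambda>x. \<psi> x * ?\<phi> x) \<longlongrightarrow> 0) at_bot"
    by (auto intro: Lim_null_comparison[OF always_eventually] bound)
  have "((\<lambda>x. k * exp (- x\<^sup>2 / 2)) has_real_derivative - x * (k * exp (- x\<^sup>2 / 2))) (at x)" for k x :: real
    by (auto intro!: derivative_eq_intros)
  then have dphi: "(?\<phi> has_real_derivative - x * ?\<phi> x) (at x)" for x
    unfolding std_normal_density_def[abs_def] .
  have cphi: "continuous_on UNIV ?\<phi>"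
    using dphi by (meson DERIV_isCont continuous_at_imp_continuous_on)
  have "(LBINT x=-\<infinity>..\<infinity>. \<psi>' x * ?\<phi> x - x * \<psi> x * ?\<phi> x) = 0 - 0"
  proof (rule interval_integral_FTC_integrable)
    show "((\<lambda>x. \<psi> x * ?\<phi> x) has_vector_derivative \<psi>' x * ?\<phi> x - x * \<psi> x * ?\<phi> x) (at x)" for x
      unfolding has_real_derivative_iff_has_vector_derivative[symmetric]
      by (rule derivative_eq_intros deriv dphi refl)+ (simp add: algebra_simps)
    show "isCont (\<lambda>x. \<psi>' x * ?\<phi> x - x * \<psi> x * ?\<phi> x) x" for x
      using cont cont_\<psi> cphi by (auto simp: continuous_on_eq_continuous_at intro!: continuous_intros)
    show "set_integrable lborel (einterval (- \<infinity>) \<infinity>) (\<lambda>x. \<psi>' x * ?\<phi> x - x * \<psi> x * ?\<phi> x)"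
      using Bochner_Integration.integrable_diff[OF j2 j1]
      by (simp add: set_integrable_def einterval_eq_UNIV mult_ac)
  qed (use lim in \<open>auto simp: ereal_tendsto_simps1\<close>)
  then have "(\<integral>x. ?\<phi> x * \<psi>' x - ?\<phi> x * (x * \<psi> x) \<partial>lborel) = 0"
    by (simp add: interval_lebesgue_integral_def einterval_eq_UNIV set_lebesgue_integral_def mult_ac)
  then have "(\<integral>x. ?\<phi> x * \<psi>' x \<partial>lborel) = (\<integral>x. ?\<phi> x * (x * \<psi> x) \<partial>lborel)"
    using j1 j2 by simp
  then show ?thesis by (subst (1 2) integral_density) auto
qed

text \<open>Regression of \<open>V\<close> on \<open>U\<close>: the residual \<open>V - U c\<close> is uncorrelated with \<open>U\<close>, hence \<open>U\<close> may be replaced by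
  a multiple of a standard normal variable independent of the residual. This reduces integration by
  parts to dimension one without a square root of the covariance matrix.\<close>

lemma gaussian0_regression_distr:
  fixes V :: "'a \<Rightarrow> 'b::euclidean_space"
  assumes "prob_space M" and UV: "gaussian0 M (\<lambda>\<omega>. (U \<omega> :: real, V \<omega>))"
    and v: "v = (\<integral>\<omega>. (U \<omega>)\<^sup>2 \<partial>M)" and c: "\<And>b. (\<integral>\<omega>. U \<omega> * (b \<bullet> V \<omega>) \<partial>M) = v * (b \<bullet> c)"
  shows "distr M borel (\<lambda>\<omega>. (U \<omega>, V \<omega>)) =
    distr (M \<Otimes>\<^sub>M std_normal_distribution) borel
      (\<lambda>z. (sqrt v * snd z, (sqrt v * snd z) *\<^sub>R c + (V (fst z) - U (fst z) *\<^sub>R c)))"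
proof -
  interpret M: prob_space M by fact
  interpret P: pair_prob_space M std_normal_distribution ..
  have [measurable]: "U \<in> borel_measurable M" "V \<in> borel_measurable M"
    using measurable_compose[OF gaussian0_measurable[OF UV] borel_measurable_continuous_onI[OF continuous_on_fst[OF continuous_on_id]]]
      measurable_compose[OF gaussian0_measurable[OF UV] borel_measurable_continuous_onI[OF continuous_on_snd[OF continuous_on_id]]]
    by simp_all
  have int: "integrable M (\<lambda>\<omega>. (U \<omega>)\<^sup>2)" "integrable M (\<lambda>\<omega>. U \<omega> * (b \<bullet> V \<omega>))"
    "integrable M (\<lambda>\<omega>. (b \<bullet> V \<omega>)\<^sup>2)" for b
    by (rule gaussian0_integrable_continuous[OF UV, where g="\<lambda>z. (fst z)\<^sup>2", unfolded fst_conv snd_conv]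
          gaussian0_integrable_continuous[OF UV, where g="\<lambda>z. fst z * (b \<bullet> snd z)", unfolded fst_conv snd_conv]
          gaussian0_integrable_continuous[OF UV, where g="\<lambda>z. (b \<bullet> snd z)\<^sup>2", unfolded fst_conv snd_conv],
        auto intro!: subgaussian_growth_intros subgaussian_growth_linear_functionals continuous_intros)+
  define R where "R \<omega> = V \<omega> - U \<omega> *\<^sub>R c" for \<omega>
  have [measurable]: "R \<in> borel_measurable M" unfolding R_def[abs_def] by measurable
  have R: "gaussian0 M R"
    using gaussian0_linear_image[OF UV, of "\<lambda>z. snd z - fst z *\<^sub>R c"]
    by (simp add: R_def[abs_def] bounded_linear_sub bounded_linear_snd bounded_linear_fst bounded_linear_scaleR_const)
  have v0: "v \<ge> 0" by (simp add: v)
  have "distr M borel (\<lambda>\<omega>. (U \<omega>, V \<omega>)) =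
    distr (M \<Otimes>\<^sub>M std_normal_distribution) borel (\<lambda>z. (sqrt v * snd z, (sqrt v * snd z) *\<^sub>R c + R (fst z)))"
  proof (rule char_eq_imp_measure_eq)
    fix d :: "real \<times> 'b"
    obtain a b where d: "d = (a, b)" by (cases d)
    \<comment> \<open>Both characteristic functions are Gaussian, so it suffices to compare
      variances: the variance of d.(U,V) equals that of b.R plus (a + b.c)^2 v.\<close>
    have "(\<integral>\<omega>. (d \<bullet> (U \<omega>, V \<omega>))\<^sup>2 \<partial>M) = (\<integral>\<omega>. a\<^sup>2 * (U \<omega>)\<^sup>2 + 2 * a * (U \<omega> * (b \<bullet> V \<omega>)) + (b \<bullet> V \<omega>)\<^sup>2 \<partial>M)"
      by (simp add: d power2_sum algebra_simps)
    also have "\<dots> = a\<^sup>2 * v + 2 * a * (v * (b \<bullet> c)) + (\<integral>\<omega>. (b \<bullet> V \<omega>)\<^sup>2 \<partial>M)"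
      using int by (simp add: c v)
    finally have 1: "(\<integral>\<omega>. (d \<bullet> (U \<omega>, V \<omega>))\<^sup>2 \<partial>M) = \<dots>" .
    have "(\<integral>\<omega>. (b \<bullet> R \<omega>)\<^sup>2 \<partial>M) =
      (\<integral>\<omega>. (b \<bullet> V \<omega>)\<^sup>2 - 2 * (b \<bullet> c) * (U \<omega> * (b \<bullet> V \<omega>)) + (b \<bullet> c)\<^sup>2 * (U \<omega>)\<^sup>2 \<partial>M)"
      by (simp add: R_def power2_eq_square inner_diff_right algebra_simps)
    also have "\<dots> = (\<integral>\<omega>. (b \<bullet> V \<omega>)\<^sup>2 \<partial>M) - 2 * (b \<bullet> c) * (v * (b \<bullet> c)) + (b \<bullet> c)\<^sup>2 * v"
      using int by (simp add: c v)
    finally have 2: "(\<integral>\<omega>. (b \<bullet> R \<omega>)\<^sup>2 \<partial>M) = \<dots>" .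
    have 3: "((a + b \<bullet> c) * sqrt v)\<^sup>2 = (a + b \<bullet> c)\<^sup>2 * v"
      using v0 by (simp add: power_mult_distrib)
    have "(CLINT z|M \<Otimes>\<^sub>M std_normal_distribution. iexp (d \<bullet> (sqrt v * snd z, (sqrt v * snd z) *\<^sub>R c + R (fst z))))
      = (CLINT z|M \<Otimes>\<^sub>M std_normal_distribution. iexp (b \<bullet> R (fst z)) * iexp (((a + b \<bullet> c) * sqrt v) * snd z))"
      by (simp add: d inner_add_right exp_add[symmetric] algebra_simps)
    also have "\<dots> = (CLINT \<omega>|M. iexp (b \<bullet> R \<omega>)) * (CLINT x|std_normal_distribution. iexp (((a + b \<bullet> c) * sqrt v) * x))"
      by (rule P.integral_bounded_product) auto
    also have "\<dots> = exp (- (\<integral>\<omega>. (b \<bullet> R \<omega>)\<^sup>2 \<partial>M) / 2) * exp (- (((a + b \<bullet> c) * sqrt v)\<^sup>2) / 2)"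
      using fun_cong[OF char_std_normal_distribution, of "(a + b \<bullet> c) * sqrt v"]
      unfolding gaussian0_char[OF R] by (simp add: char_def)
    also have "\<dots> = exp (- (\<integral>\<omega>. (d \<bullet> (U \<omega>, V \<omega>))\<^sup>2 \<partial>M) / 2)"
      unfolding 1 2 3 of_real_mult[symmetric] exp_add[symmetric]
      by (simp add: power2_sum algebra_simps add_divide_distrib power2_eq_square diff_divide_distrib)
    also have "\<dots> = (CLINT \<omega>|M. iexp (d \<bullet> (U \<omega>, V \<omega>)))"
      by (rule gaussian0_char[OF UV, symmetric])
    finally show "(CLINT x|distr M borel (\<lambda>\<omega>. (U \<omega>, V \<omega>)). iexp (d \<bullet> x)) =
      (CLINT x|distr (M \<Otimes>\<^sub>M std_normal_distribution) borel (\<lambda>z. (sqrt v * snd z, (sqrt v * snd z) *\<^sub>R c + R (fst z))). iexp (d \<bullet> x))"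
      by (simp add: integral_distr)
  qed (auto intro!: M.prob_space_distr P.prob_space_distr)
  then show ?thesis by (simp add: R_def)
qed

text \<open>Only the covariance vector \<open>w\<close> of \<open>U\<close> and \<open>V\<close>
  matters: the right-hand side is the mean of the derivative of \<open>G\<close> in direction
  \<open>w\<close>. Regression replaces \<open>U\<close> by an independent normal variable, and the
  one-dimensional formula is used with the residual frozen.\<close>

theorem gaussian0_integration_by_parts:
  fixes V :: "'a \<Rightarrow> 'b::euclidean_space"
  assumes "prob_space M" and UV: "gaussian0 M (\<lambda>\<omega>. (U \<omega> :: real, V \<omega>))"
    and deriv: "\<And>x. (G has_derivative (\<lambda>h. D x \<bullet> h)) (at x)"
    and cont: "continuous_on UNIV D" and G: "subgaussian_growth G"
    and D: "\<And>h. subgaussian_growth (\<lambda>x. D x \<bullet> h)"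
  shows "(\<integral>\<omega>. U \<omega> * G (V \<omega>) \<partial>M) =
    (\<Sum>b\<in>Basis. (\<integral>\<omega>. U \<omega> * (V \<omega> \<bullet> b) \<partial>M) * (\<integral>\<omega>. D (V \<omega>) \<bullet> b \<partial>M))"
proof -
  interpret M: prob_space M by fact
  interpret P: pair_prob_space M std_normal_distribution ..
  have [measurable]: "U \<in> borel_measurable M" "V \<in> borel_measurable M"
    using measurable_compose[OF gaussian0_measurable[OF UV] borel_measurable_continuous_onI[OF continuous_on_fst[OF continuous_on_id]]]
      measurable_compose[OF gaussian0_measurable[OF UV] borel_measurable_continuous_onI[OF continuous_on_snd[OF continuous_on_id]]]
    by simp_all
  have contG: "continuous_on UNIV G"
    using deriv by (meson continuous_at_imp_continuous_on has_derivative_continuous)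
  note [measurable] = borel_measurable_continuous_onI[OF contG] borel_measurable_continuous_onI[OF cont]
  have int: "integrable M (\<lambda>\<omega>. (U \<omega>)\<^sup>2)" "integrable M (\<lambda>\<omega>. U \<omega> * (V \<omega> \<bullet> b))"
    "integrable M (\<lambda>\<omega>. U \<omega> * G (V \<omega>))" "integrable M (\<lambda>\<omega>. D (V \<omega>) \<bullet> b)" for b
    by (rule gaussian0_integrable_continuous[OF UV, where g="\<lambda>z. (fst z)\<^sup>2", unfolded fst_conv snd_conv]
          gaussian0_integrable_continuous[OF UV, where g="\<lambda>z. fst z * (snd z \<bullet> b)", unfolded fst_conv snd_conv]
          gaussian0_integrable_continuous[OF UV, where g="\<lambda>z. fst z * G (snd z)", unfolded fst_conv snd_conv]
          gaussian0_integrable_continuous[OF UV, where g="\<lambda>z. D (snd z) \<bullet> b", unfolded fst_conv snd_conv],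
        auto intro!: subgaussian_growth_intros subgaussian_growth_linear_functionals continuous_intros
          subgaussian_growth_bounded_linear[OF bounded_linear_snd, of G]
          subgaussian_growth_bounded_linear[OF bounded_linear_snd, of "\<lambda>x. D x \<bullet> b"]
          G D continuous_on_compose2[OF contG] continuous_on_compose2[OF cont])+
  define v where "v = (\<integral>\<omega>. (U \<omega>)\<^sup>2 \<partial>M)"
  have v0: "v \<ge> 0" by (simp add: v_def)
  define w where "w = (\<Sum>b\<in>Basis. (\<integral>\<omega>. U \<omega> * (V \<omega> \<bullet> b) \<partial>M) *\<^sub>R b)"
  have wb: "(\<integral>\<omega>. U \<omega> * (a \<bullet> V \<omega>) \<partial>M) = a \<bullet> w" for a
  proof -
    have "(\<integral>\<omega>. U \<omega> * (a \<bullet> V \<omega>) \<partial>M) = (\<integral>\<omega>. (\<Sum>b\<in>Basis. (a \<bullet> b) * (U \<omega> * (V \<omega> \<bullet> b))) \<partial>M)"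
      by (subst euclidean_inner) (simp add: sum_distrib_left mult_ac)
    also have "\<dots> = (\<Sum>b\<in>Basis. (a \<bullet> b) * (\<integral>\<omega>. U \<omega> * (V \<omega> \<bullet> b) \<partial>M))"
      using int(2) by (simp add: Bochner_Integration.integral_sum)
    finally show ?thesis by (simp add: w_def inner_sum_right mult_ac)
  qed
  \<comment> \<open>If \<open>v = 0\<close> then \<open>U\<close> vanishes almost surely; testing
    the covariance against \<open>w\<close> itself gives \<open>w \<bullet> w = 0\<close>.\<close>
  have w0: "w = 0" if "v = 0"
  proof -
    have "AE \<omega> in M. (U \<omega>)\<^sup>2 = 0"
      using that int(1) unfolding v_def by (subst (asm) integral_nonneg_eq_0_iff_AE) auto
    then have "(\<integral>\<omega>. U \<omega> * (w \<bullet> V \<omega>) \<partial>M) = (\<integral>\<omega>. 0 \<partial>M)"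
      by (intro integral_cong_AE) auto
    then show ?thesis using wb[of w] by simp
  qed
  \<comment> \<open>\<open>c = 0\<close> if \<open>v = 0\<close>, in accordance with \<open>w0\<close>\<close>
  define c where "c = (1 / v) *\<^sub>R w"
  have wc: "w = v *\<^sub>R c" using w0 by (auto simp: c_def)
  define \<sigma> where "\<sigma> = sqrt v"
  define R where "R \<omega> = V \<omega> - U \<omega> *\<^sub>R c" for \<omega>
  have [measurable]: "R \<in> borel_measurable M" unfolding R_def[abs_def] by measurable
  have law: "distr M borel (\<lambda>\<omega>. (U \<omega>, V \<omega>)) =
    distr (M \<Otimes>\<^sub>M std_normal_distribution) borel
      (\<lambda>z. (\<sigma> * snd z, (\<sigma> * snd z) *\<^sub>R c + R (fst z)))"
    unfolding \<sigma>_def R_def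
    by (rule gaussian0_regression_distr[OF assms(1) UV v_def]) (simp add: wb wc)
  \<comment> \<open>Fubini puts the normal variable innermost, so that \<open>R \<omega>\<close> is
    a constant there.\<close>
  have transfer: "(\<integral>\<omega>. h (U \<omega>, V \<omega>) \<partial>M) =
      (\<integral>\<omega>. (\<integral>x. h (\<sigma> * x, (\<sigma> * x) *\<^sub>R c + R \<omega>) \<partial>std_normal_distribution) \<partial>M)"
    if [measurable]: "h \<in> borel_measurable borel" and i: "integrable M (\<lambda>\<omega>. h (U \<omega>, V \<omega>))"
    for h :: "real \<times> 'b \<Rightarrow> real"
  proof -
    have "integrable (M \<Otimes>\<^sub>M std_normal_distribution) (\<lambda>z. h (\<sigma> * snd z, (\<sigma> * snd z) *\<^sub>R c + R (fst z)))"
      using i distr_eq_integrable_iff[OF law, where h=h] by simp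
    from P.integral_fst'[OF this] distr_eq_integral_eq[OF law, where h=h] show ?thesis by simp
  qed
  \<comment> \<open>The argument moves in direction sigma c, and \<open>U\<close> contributes
    another factor sigma; the product sigma^2 c is \<open>w\<close>.\<close>
  have by_parts: "(\<integral>x. (\<sigma> * x) * G ((\<sigma> * x) *\<^sub>R c + r) \<partial>std_normal_distribution)
      = (\<integral>x. D ((\<sigma> * x) *\<^sub>R c + r) \<bullet> w \<partial>std_normal_distribution)" for r
  proof -
    have bl: "bounded_linear (\<lambda>x::real. (\<sigma> * x) *\<^sub>R c)" by (intro bounded_linear_intros)
    have "(\<integral>x. x * G ((\<sigma> * x) *\<^sub>R c + r) \<partial>std_normal_distribution)
      = (\<integral>x. D ((\<sigma> * x) *\<^sub>R c + r) \<bullet> (\<sigma> *\<^sub>R c) \<partial>std_normal_distribution)"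
    proof (rule std_normal_integration_by_parts)
      fix x
      have "((\<lambda>x. (\<sigma> * x) *\<^sub>R c + r) has_derivative (\<lambda>h. (\<sigma> * h) *\<^sub>R c)) (at x)"
        by (auto intro!: derivative_eq_intros)
      from has_derivative_compose[OF this deriv]
      show "((\<lambda>x. G ((\<sigma> * x) *\<^sub>R c + r)) has_real_derivative D ((\<sigma> * x) *\<^sub>R c + r) \<bullet> (\<sigma> *\<^sub>R c)) (at x)"
        by (simp add: has_field_derivative_def mult_ac mult_commute_abs)
      show "continuous_on UNIV (\<lambda>x. D ((\<sigma> * x) *\<^sub>R c + r) \<bullet> (\<sigma> *\<^sub>R c))"
        by (intro continuous_intros continuous_on_compose2[OF cont]) auto
      show "subgaussian_growth (\<lambda>x. G ((\<sigma> * x) *\<^sub>R c + r))"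
        using subgaussian_growth_bounded_linear[OF bl subgaussian_growth_shift[OF G]] .
      show "subgaussian_growth (\<lambda>x. D ((\<sigma> * x) *\<^sub>R c + r) \<bullet> (\<sigma> *\<^sub>R c))"
        using subgaussian_growth_bounded_linear[OF bl subgaussian_growth_shift[OF D]] .
    qed
    then have "\<sigma> * (\<integral>x. x * G ((\<sigma> * x) *\<^sub>R c + r) \<partial>std_normal_distribution)
      = \<sigma> * (\<integral>x. D ((\<sigma> * x) *\<^sub>R c + r) \<bullet> (\<sigma> *\<^sub>R c) \<partial>std_normal_distribution)" by simp
    moreover have "D y \<bullet> w = \<sigma> * (D y \<bullet> (\<sigma> *\<^sub>R c))" for y
      using v0 by (simp add: wc \<sigma>_def mult.assoc[symmetric])
    ultimately show ?thesis by (simp add: mult.assoc)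
  qed
  have [measurable]: "(\<lambda>z::real \<times> 'b. fst z * G (snd z)) \<in> borel_measurable borel"
      "(\<lambda>z::real \<times> 'b. D (snd z) \<bullet> w) \<in> borel_measurable borel"
    by (auto intro!: borel_measurable_continuous_onI continuous_intros
        continuous_on_compose2[OF contG] continuous_on_compose2[OF cont])
  have iw: "integrable M (\<lambda>\<omega>. D (V \<omega>) \<bullet> w)" by (rule int(4))
  have "(\<integral>\<omega>. U \<omega> * G (V \<omega>) \<partial>M) =
      (\<integral>\<omega>. (\<integral>x. (\<sigma> * x) * G ((\<sigma> * x) *\<^sub>R c + R \<omega>) \<partial>std_normal_distribution) \<partial>M)"
    using transfer[of "\<lambda>z. fst z * G (snd z)"] int(3) by simp
  also have "\<dots> = (\<integral>\<omega>. D (V \<omega>) \<bullet> w \<partial>M)"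
    unfolding by_parts using transfer[of "\<lambda>z. D (snd z) \<bullet> w"] iw by simp
  also have "\<dots> = (\<Sum>b\<in>Basis. (\<integral>\<omega>. U \<omega> * (V \<omega> \<bullet> b) \<partial>M) * (\<integral>\<omega>. D (V \<omega>) \<bullet> b \<partial>M))"
    unfolding w_def using int(4) by (simp add: inner_sum_right Bochner_Integration.integral_sum)
  finally show ?thesis .
qed

section \<open>Functions with two derivatives of moderate growth\<close>

lemma sum_Basis_vec: "(\<Sum>b\<in>(Basis :: (real ^ 'n) set). F b) = (\<Sum>i\<in>UNIV. F (axis i 1))"
proof -
  have "Basis = range (\<lambda>i. axis i 1 :: real ^ 'n)" by (auto simp: Basis_vec_def)
  moreover have "inj (\<lambda>i. axis i 1 :: real ^ 'n)" by (auto simp: inj_def axis_eq_axis)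
  ultimately have "sum F Basis = sum (F \<circ> (\<lambda>i. axis i 1)) (UNIV :: 'n set)"
    using sum.reindex by metis
  then show ?thesis by (simp add: o_def)
qed

lemma linear_sum_axis:
  fixes L :: "real ^ 'n \<Rightarrow> real"
  assumes "linear L"
  shows "L h = (\<Sum>i\<in>UNIV. h $ i * L (axis i 1))"
proof -
  have "L h = L (\<Sum>i\<in>UNIV. h $ i *\<^sub>R axis i 1)"
    using basis_expansion[of h] by (simp add: scalar_mult_eq_scaleR)
  then show ?thesis
    using assms by (simp add: linear_sum linear_scale)
qed

text \<open>The chain rule along each axis identifies \<open>partial_deriv\<close> with the value of
  the total derivative on a basis vector; linearity does the rest.\<close>

lemma has_derivative_partial_deriv:
  assumes "f differentiable (at x)"
  shows "(f has_derivative (\<lambda>h. \<Sum>i\<in>UNIV. h $ i * partial_deriv i f x)) (at x)"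
proof -
  obtain f' where f': "(f has_derivative f') (at x)"
    using assms by (auto simp: differentiable_def)
  have "f' (axis i 1) = partial_deriv i f x" for i
  proof -
    have "((\<lambda>t::real. x + t *\<^sub>R axis i 1) has_derivative (\<lambda>t. t *\<^sub>R axis i 1)) (at 0)"
      by (auto intro!: derivative_eq_intros)
    from has_derivative_compose[OF this, of f f'] f'
    have "((\<lambda>t. f (x + t *\<^sub>R axis i 1)) has_derivative (\<lambda>t. f' (t *\<^sub>R axis i 1))) (at 0)" by simp
    then have "((\<lambda>t. f (x + t *\<^sub>R axis i 1)) has_real_derivative f' (axis i 1)) (at 0)"
      using has_derivative_linear[OF f']
      by (simp add: has_field_derivative_def linear_scale mult_commute_abs)
    then show ?thesis by (simp add: partial_deriv_def DERIV_imp_deriv)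
  qed
  then have "f' = (\<lambda>h. \<Sum>i\<in>UNIV. h $ i * partial_deriv i f x)"
    by (intro ext, subst linear_sum_axis[OF has_derivative_linear[OF f']]) simp
  then show ?thesis using f' by simp
qed

text \<open>\<open>g\<close> plays the role of the gradient and \<open>H i j\<close> that of \<open>\<partial>\<^sub>i \<partial>\<^sub>j f\<close>.\<close>

definition C2_growth ::
  "(real ^ 'n \<Rightarrow> real) \<Rightarrow> ('n \<Rightarrow> real ^ 'n \<Rightarrow> real) \<Rightarrow> ('n \<Rightarrow> 'n \<Rightarrow> real ^ 'n \<Rightarrow> real) \<Rightarrow> bool" where
  "C2_growth f g H \<longleftrightarrow>
     (\<forall>x. (f has_derivative (\<lambda>h. \<Sum>i\<in>UNIV. h $ i * g i x)) (at x)) \<and>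
     (\<forall>j x. (g j has_derivative (\<lambda>h. \<Sum>i\<in>UNIV. h $ i * H i j x)) (at x)) \<and>
     (\<forall>i j. continuous_on UNIV (H i j)) \<and>
     subgaussian_growth f \<and> (\<forall>i. subgaussian_growth (g i)) \<and> (\<forall>i j. subgaussian_growth (H i j))"

lemma has_derivative_imp_continuous_on_UNIV:
  "(\<And>x. (f has_derivative f' x) (at x)) \<Longrightarrow> continuous_on UNIV f"
  by (meson continuous_at_imp_continuous_on has_derivative_continuous)

lemma C2_growth_continuous:
  assumes "C2_growth f g H"
  shows "continuous_on UNIV f" "continuous_on UNIV (g i)" "continuous_on UNIV (H i j)"
proof -
  show "continuous_on UNIV f"
    by (rule has_derivative_imp_continuous_on_UNIV[where f'="\<lambda>x h. \<Sum>k\<in>UNIV. h $ k * g k x"])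
      (use assms in \<open>simp add: C2_growth_def\<close>)
  show "continuous_on UNIV (g i)"
    by (rule has_derivative_imp_continuous_on_UNIV[where f'="\<lambda>x h. \<Sum>k\<in>UNIV. h $ k * H k i x"])
      (use assms in \<open>simp add: C2_growth_def\<close>)
  show "continuous_on UNIV (H i j)" using assms by (simp add: C2_growth_def)
qed

lemma C2_fun_imp_C2_growth:
  fixes f :: "real ^ 'n \<Rightarrow> real"
  assumes f: "C2_fun f" and "moderate_growth f"
    and "\<And>i. moderate_growth (partial_deriv i f)"
    and "\<And>i j. moderate_growth (partial_deriv i (partial_deriv j f))"
  shows "C2_growth f (\<lambda>i. partial_deriv i f) (\<lambda>i j. partial_deriv i (partial_deriv j f))"
proof -
  have d: "f differentiable (at x)" "partial_deriv i f differentiable (at x)" for i x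
    using f by (auto simp: C2_fun_def C1_fun_def differentiable_on_def)
  have c: "continuous_on UNIV (partial_deriv i f)"
    "continuous_on UNIV (partial_deriv i (partial_deriv j f))" for i j
    using f by (auto simp: C2_fun_def C1_fun_def)
  have cf: "continuous_on UNIV f"
    using f by (auto simp: C2_fun_def C1_fun_def intro: differentiable_imp_continuous_on)
  show ?thesis
    unfolding C2_growth_def
    using has_derivative_partial_deriv d c cf assms moderate_growth_imp_subgaussian by blast
qed

lemma gaussian0_integration_by_parts_vec:
  fixes V :: "'a \<Rightarrow> real ^ 'n"
  assumes "prob_space M" and UV: "gaussian0 M (\<lambda>\<omega>. (U \<omega> :: real, V \<omega>))"
    and deriv: "\<And>x. (G has_derivative (\<lambda>h. \<Sum>i\<in>UNIV. h $ i * dG i x)) (at x)"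
    and cont: "\<And>i. continuous_on UNIV (dG i)" and G: "subgaussian_growth G"
    and dG: "\<And>i. subgaussian_growth (dG i)"
  shows "(\<integral>\<omega>. U \<omega> * G (V \<omega>) \<partial>M) =
    (\<Sum>i\<in>UNIV. (\<integral>\<omega>. U \<omega> * V \<omega> $ i \<partial>M) * (\<integral>\<omega>. dG i (V \<omega>) \<partial>M))"
proof -
  have D: "(\<chi> i. dG i x) \<bullet> h = (\<Sum>i\<in>UNIV. h $ i * dG i x)" for x h
    by (simp add: inner_vec_def mult.commute)
  have "(\<integral>\<omega>. U \<omega> * G (V \<omega>) \<partial>M) =
    (\<Sum>b\<in>Basis. (\<integral>\<omega>. U \<omega> * (V \<omega> \<bullet> b) \<partial>M) * (\<integral>\<omega>. (\<chi> i. dG i (V \<omega>)) \<bullet> b \<partial>M))"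
    by (rule gaussian0_integration_by_parts[OF assms(1) UV])
      (auto simp: D intro!: deriv G continuous_intros cont subgaussian_growth_intros dG)
  then show ?thesis by (simp add: sum_Basis_vec inner_axis)
qed

lemma gaussian0_imp_component_pair:
  fixes X :: "'a \<Rightarrow> real ^ 'n"
  assumes "gaussian0 M X"
  shows "gaussian0 M (\<lambda>\<omega>. (X \<omega> $ j, X \<omega>))"
  by (rule gaussian0_linear_image[OF assms, of "\<lambda>x. (x $ j, x)"])
    (intro bounded_linear_Pair bounded_linear_vec_nth bounded_linear_ident)

section \<open>The projection onto the orthogonal complement\<close>

lemma subgaussian_growth_vec_linear:
  "subgaussian_growth (\<lambda>x::real ^ 'n. x $ i)"
  "subgaussian_growth (\<lambda>x::real ^ 'n. q \<bullet> x)"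
  by (rule subgaussian_growth_linear, intro bounded_linear_vec_nth bounded_linear_inner_right)+

text \<open>These will be the coefficients of the orthogonal projection of \<open>f(X)\<close> onto
  the Gaussian space.\<close>

definition mean_gradient :: "'a measure \<Rightarrow> ('a \<Rightarrow> real ^ 'n) \<Rightarrow> ('n \<Rightarrow> real ^ 'n \<Rightarrow> real) \<Rightarrow> real ^ 'n" where
  "mean_gradient M X g = (\<chi> i. \<integral>\<omega>. g i (X \<omega>) \<partial>M)"

text \<open>Integration by parts with \<open>U\<close> the coordinate \<open>j\<close> of
  \<open>X\<close> expresses the covariance of \<open>f(X)\<close> with it as the covariance of p.X
  with it.\<close>

lemma residual_orthogonal:
  fixes X :: "'a \<Rightarrow> real ^ 'n"
  assumes "prob_space M" and X: "gaussian0 M X" and f: "C2_growth f g H"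
  shows "(\<integral>\<omega>. (f (X \<omega>) - mean_gradient M X g \<bullet> X \<omega>) * X \<omega> $ j \<partial>M) = 0"
proof -
  let ?p = "mean_gradient M X g"
  note c = C2_growth_continuous[OF f]
  have sg: "subgaussian_growth f" "\<And>i. subgaussian_growth (g i)"
    using f by (auto simp: C2_growth_def)
  have int: "integrable M (\<lambda>\<omega>. f (X \<omega>) * X \<omega> $ j)" "integrable M (\<lambda>\<omega>. X \<omega> $ i * X \<omega> $ j)" for i
    using gaussian0_integrable_continuous[OF X, of "\<lambda>x. f x * x $ j"]
      gaussian0_integrable_continuous[OF X, of "\<lambda>x. x $ i * x $ j"]
    by (simp_all add: subgaussian_growth_intros sg subgaussian_growth_vec_linear continuous_intros c)
  have "(\<integral>\<omega>. X \<omega> $ j * f (X \<omega>) \<partial>M) =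
    (\<Sum>i\<in>UNIV. (\<integral>\<omega>. X \<omega> $ j * X \<omega> $ i \<partial>M) * (\<integral>\<omega>. g i (X \<omega>) \<partial>M))"
    using f by (intro gaussian0_integration_by_parts_vec[OF assms(1) gaussian0_imp_component_pair[OF X]] c sg)
      (auto simp: C2_growth_def)
  also have "\<dots> = (\<integral>\<omega>. (\<Sum>i\<in>UNIV. ?p $ i * (X \<omega> $ i * X \<omega> $ j)) \<partial>M)"
    using int(2) by (simp add: mean_gradient_def mult.commute Bochner_Integration.integral_sum)
  finally have "(\<integral>\<omega>. f (X \<omega>) * X \<omega> $ j \<partial>M) = (\<integral>\<omega>. (\<Sum>i\<in>UNIV. ?p $ i * (X \<omega> $ i * X \<omega> $ j)) \<partial>M)"
    by (simp add: mult.commute)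
  moreover have "(f (X \<omega>) - ?p \<bullet> X \<omega>) * X \<omega> $ j
    = f (X \<omega>) * X \<omega> $ j - (\<Sum>i\<in>UNIV. ?p $ i * (X \<omega> $ i * X \<omega> $ j))" for \<omega>
    by (simp add: inner_vec_def left_diff_distrib sum_distrib_right mult.assoc)
  ultimately show ?thesis using int by simp
qed

definition residual :: "(real ^ 'n \<Rightarrow> real) \<Rightarrow> real \<Rightarrow> real ^ 'n \<Rightarrow> real ^ 'n \<Rightarrow> real" where
  "residual f lam q x = f x - q \<bullet> x + lam"

lemma residual_growth:
  assumes "C2_growth f g H"
  shows "subgaussian_growth (residual f lam q)" "continuous_on UNIV (residual f lam q)"
  using assms C2_growth_continuous[OF assms] unfolding residual_def[abs_def] C2_growth_def
  by (auto intro!: subgaussian_growth_intros subgaussian_growth_vec_linear continuous_intros)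

text \<open>Pythagoras: changing \<open>q\<close> away from the mean gradient \<open>p\<close> adds
  (p - q).X, whose product with the residual has mean zero.\<close>

lemma integral_residual_square_minimal:
  fixes X :: "'a \<Rightarrow> real ^ 'n"
  assumes "prob_space M" and X: "gaussian0 M X" and f: "C2_growth f g H"
  shows "(\<integral>\<omega>. (residual f lam (mean_gradient M X g) (X \<omega>))\<^sup>2 \<partial>M) \<le> (\<integral>\<omega>. (residual f lam q (X \<omega>))\<^sup>2 \<partial>M)"
proof -
  let ?p = "mean_gradient M X g"
  let ?r = "residual f lam ?p"
  note rg = residual_growth[OF f]
  have c: "continuous_on UNIV f" using C2_growth_continuous[OF f] by simp
  have sg: "subgaussian_growth f" using f by (auto simp: C2_growth_def)
  have int: "integrable M (\<lambda>\<omega>. (?r (X \<omega>))\<^sup>2)" "integrable M (\<lambda>\<omega>. (f (X \<omega>) - ?p \<bullet> X \<omega>) * X \<omega> $ i)"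
    "integrable M (\<lambda>\<omega>. X \<omega> $ i)" "integrable M (\<lambda>\<omega>. ((?p - q) \<bullet> X \<omega>)\<^sup>2)" for i
    using gaussian0_integrable_continuous[OF X, of "\<lambda>x. (?r x)\<^sup>2"]
      gaussian0_integrable_continuous[OF X, of "\<lambda>x. (f x - ?p \<bullet> x) * x $ i"]
      gaussian0_integrable_continuous[OF X, of "\<lambda>x. x $ i"]
      gaussian0_integrable_continuous[OF X, of "\<lambda>x. ((?p - q) \<bullet> x)\<^sup>2"]
    by (simp_all add: subgaussian_growth_intros subgaussian_growth_vec_linear continuous_intros c sg rg)
  have EX: "(\<integral>\<omega>. X \<omega> $ i \<partial>M) = 0" for i
    using gaussian0_second_moment(2)[OF X, of "axis i 1"] by (simp add: inner_axis inner_commute)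
  \<comment> \<open>The cross term is split so that orthogonality kills the first summand and
    centering of \<open>X\<close> kills the one with \<open>lam\<close>.\<close>
  let ?c = "\<lambda>\<omega> i. ((?p - q) $ i) * ((f (X \<omega>) - ?p \<bullet> X \<omega>) * X \<omega> $ i + lam * X \<omega> $ i)"
  have expand: "(residual f lam q (X \<omega>))\<^sup>2 = (?r (X \<omega>))\<^sup>2 + 2 * (\<Sum>i\<in>UNIV. ?c \<omega> i) + ((?p - q) \<bullet> X \<omega>)\<^sup>2" for \<omega>
  proof -
    have "(\<Sum>i\<in>UNIV. ?c \<omega> i) = ?r (X \<omega>) * (\<Sum>i\<in>UNIV. ((?p - q) $ i) * X \<omega> $ i)"
      unfolding sum_distrib_left residual_def by (intro sum.cong refl) (simp add: algebra_simps)
    also have "\<dots> = ?r (X \<omega>) * ((?p - q) \<bullet> X \<omega>)" by (simp add: inner_vec_def)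
    finally have "(\<Sum>i\<in>UNIV. ?c \<omega> i) = \<dots>" .
    moreover have "residual f lam q (X \<omega>) = ?r (X \<omega>) + (?p - q) \<bullet> X \<omega>"
      by (simp add: residual_def inner_diff_left)
    ultimately show ?thesis by (simp only: power2_sum mult.assoc)
  qed
  have ic: "integrable M (\<lambda>\<omega>. ?c \<omega> i)" for i
    using int by (intro integrable_mult_right Bochner_Integration.integrable_add)
  have zero: "(\<integral>\<omega>. ?c \<omega> i \<partial>M) = 0" for i
  proof -
    have "(\<integral>\<omega>. ?c \<omega> i \<partial>M) = ((?p - q) $ i) * ((\<integral>\<omega>. (f (X \<omega>) - ?p \<bullet> X \<omega>) * X \<omega> $ i \<partial>M) + lam * (\<integral>\<omega>. X \<omega> $ i \<partial>M))"
      using int by simp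
    then show ?thesis using residual_orthogonal[OF assms] EX by simp
  qed
  define S where "S \<omega> = (\<Sum>i\<in>UNIV. ?c \<omega> i)" for \<omega>
  have S: "integrable M S" "(\<integral>\<omega>. S \<omega> \<partial>M) = 0"
    unfolding S_def by (rule Bochner_Integration.integrable_sum[OF ic])
      (simp only: Bochner_Integration.integral_sum[OF ic] zero sum.neutral_const)
  have "(\<integral>\<omega>. (residual f lam q (X \<omega>))\<^sup>2 \<partial>M) = (\<integral>\<omega>. (?r (X \<omega>))\<^sup>2 \<partial>M) + (\<integral>\<omega>. ((?p - q) \<bullet> X \<omega>)\<^sup>2 \<partial>M)"
    unfolding expand S_def[symmetric] using int(1,4) S by simp
  then show ?thesis by simp
qed

text \<open>f(X) - p.X is orthogonal to the Gaussian space, and the removed part p.X is orthogonal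
  to everything in the complement; uniqueness identifies it with the projection.\<close>

lemma integral_orth_proj_residual:
  fixes X :: "'a \<Rightarrow> real ^ 'n"
  assumes "prob_space M" and X: "gaussian0 M X" and f: "C2_growth f g H"
  shows "(\<integral>\<omega>. (orth_proj M (orth_compl M (gaussian_space X)) (\<lambda>\<omega>. f (X \<omega>)) \<omega> + lam)\<^sup>2 \<partial>M)
    = (\<integral>\<omega>. (residual f lam (mean_gradient M X g) (X \<omega>))\<^sup>2 \<partial>M)"
proof -
  let ?p = "mean_gradient M X g"
  let ?O = "orth_compl M (gaussian_space X)"
  let ?h = "\<lambda>\<omega>. f (X \<omega>) - ?p \<bullet> X \<omega>"
  let ?P = "orth_proj M ?O (\<lambda>\<omega>. f (X \<omega>))"
  have c: "continuous_on UNIV f" using C2_growth_continuous[OF f] by simp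
  have sg: "subgaussian_growth f" using f by (auto simp: C2_growth_def)
  note [measurable] = gaussian0_measurable[OF X] borel_measurable_continuous_onI[OF c]
  have int: "integrable M (\<lambda>\<omega>. (?h \<omega>)\<^sup>2)" "integrable M (\<lambda>\<omega>. (?p \<bullet> X \<omega>)\<^sup>2)"
    "integrable M (\<lambda>\<omega>. ?h \<omega> * X \<omega> $ i)" for i
    using gaussian0_integrable_continuous[OF X, of "\<lambda>x. (f x - ?p \<bullet> x)\<^sup>2"]
      gaussian0_integrable_continuous[OF X, of "\<lambda>x. (?p \<bullet> x)\<^sup>2"]
      gaussian0_integrable_continuous[OF X, of "\<lambda>x. (f x - ?p \<bullet> x) * x $ i"]
    by (simp_all add: subgaussian_growth_intros subgaussian_growth_vec_linear continuous_intros c sg)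
  have hO: "?h \<in> ?O"
    unfolding orth_compl_def
  proof (intro CollectI conjI ballI)
    show "?h \<in> L2 M" using int by (simp add: L2_def)
    fix k assume "k \<in> gaussian_space X"
    then obtain a where k: "k = (\<lambda>\<omega>. \<Sum>i\<in>UNIV. a i * X \<omega> $ i)" by (auto simp: gaussian_space_def)
    have "(\<integral>\<omega>. ?h \<omega> * k \<omega> \<partial>M) = (\<integral>\<omega>. (\<Sum>i\<in>UNIV. a i * (?h \<omega> * X \<omega> $ i)) \<partial>M)"
      unfolding k by (intro Bochner_Integration.integral_cong refl, subst sum_distrib_left) (simp add: mult_ac)
    also have "\<dots> = (\<Sum>i\<in>UNIV. a i * (\<integral>\<omega>. ?h \<omega> * X \<omega> $ i \<partial>M))"
      using int(3) by (simp add: Bochner_Integration.integral_sum)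
    finally show "(\<integral>\<omega>. ?h \<omega> * k \<omega> \<partial>M) = 0" by (simp add: residual_orthogonal[OF assms])
  qed
  have pH: "(\<lambda>\<omega>. ?p \<bullet> X \<omega>) \<in> gaussian_space X"
    by (auto simp: gaussian_space_def inner_vec_def intro!: exI[of _ "\<lambda>i. ?p $ i"])
  have "(\<lambda>\<omega>. ?p \<bullet> X \<omega>) \<in> orth_compl M ?O"
    unfolding orth_compl_def[of M ?O]
  proof (intro CollectI conjI ballI)
    show "(\<lambda>\<omega>. ?p \<bullet> X \<omega>) \<in> L2 M" using int by (simp add: L2_def)
    fix k assume "k \<in> ?O"
    then have "(\<integral>\<omega>. k \<omega> * (?p \<bullet> X \<omega>) \<partial>M) = 0" using pH by (auto simp: orth_compl_def)
    then show "(\<integral>\<omega>. (?p \<bullet> X \<omega>) * k \<omega> \<partial>M) = 0" by (simp add: mult.commute)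
  qed
  then have ex: "?h \<in> ?O \<and> (\<lambda>\<omega>. f (X \<omega>) - ?h \<omega>) \<in> orth_compl M ?O" using hO by simp
  \<comment> \<open>The pair of memberships just shown is the witness that makes the choice in
    \<open>orth_proj\<close> meaningful.\<close>
  then have P: "?P \<in> ?O \<and> (\<lambda>\<omega>. f (X \<omega>) - ?P \<omega>) \<in> orth_compl M ?O"
    unfolding orth_proj_def
    by (rule someI[where P="\<lambda>h. h \<in> ?O \<and> (\<lambda>\<omega>. f (X \<omega>) - h \<omega>) \<in> orth_compl M ?O"])
  have "AE \<omega> in M. ?P \<omega> = ?h \<omega>"
    by (rule orth_proj_AE_unique[of ?O M ?P "\<lambda>\<omega>. f (X \<omega>)" ?h]) (use ex P in \<open>auto simp: orth_compl_def\<close>)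
  moreover have "?P \<in> borel_measurable M" using P by (auto simp: orth_compl_def L2_def)
  ultimately show ?thesis
    unfolding residual_def by (intro integral_cong_AE) auto
qed

section \<open>Gaussian interpolation\<close>

text \<open>With \<open>z = (X, Y)\<close>, the second component is the interpolation \<open>X\<^sub>\<theta>\<close> and the first one its derivative
  in \<open>\<theta>\<close>. Since rotations are isometries, a single function of \<open>norm z\<close> dominates all \<open>\<theta>\<close>.\<close>

definition rotation :: "real \<Rightarrow> 'b::euclidean_space \<times> 'b \<Rightarrow> 'b \<times> 'b" where
  "rotation \<theta> z = (cos \<theta> *\<^sub>R snd z - sin \<theta> *\<^sub>R fst z, cos \<theta> *\<^sub>R fst z + sin \<theta> *\<^sub>R snd z)"

lemma bounded_linear_rotation: "bounded_linear (rotation \<theta>)"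
  unfolding rotation_def[abs_def]
  by (intro bounded_linear_Pair bounded_linear_add bounded_linear_sub bounded_linear_const_scaleR
      bounded_linear_fst bounded_linear_snd)

lemma norm_rotation:
  fixes z :: "'b::euclidean_space \<times> 'b"
  shows "norm (rotation \<theta> z) = norm z"
proof -
  have "(c *\<^sub>R b - s *\<^sub>R a) \<bullet> (c *\<^sub>R b - s *\<^sub>R a) + (c *\<^sub>R a + s *\<^sub>R b) \<bullet> (c *\<^sub>R a + s *\<^sub>R b)
    = (s\<^sup>2 + c\<^sup>2) * (a \<bullet> a + b \<bullet> b)" for a b :: 'b and s c :: real
    by (simp add: inner_diff_left inner_diff_right inner_add_left inner_add_right
        inner_commute power2_eq_square algebra_simps)
  from this[of "cos \<theta>" "snd z" "sin \<theta>" "fst z"]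
  have "rotation \<theta> z \<bullet> rotation \<theta> z = z \<bullet> z"
    by (cases z) (simp add: rotation_def)
  then show ?thesis by (simp add: norm_eq_sqrt_inner)
qed

lemma rotation_dominated:
  fixes Z :: "'a \<Rightarrow> 'b::euclidean_space \<times> 'b"
  assumes Z: "gaussian0 M Z" and \<Phi>: "subgaussian_growth \<Phi>"
  obtains w where "integrable M w" "\<And>\<theta> \<omega>. \<bar>\<Phi> (rotation \<theta> (Z \<omega>))\<bar> \<le> w \<omega>"
proof -
  obtain a where a: "a > 0" "integrable M (\<lambda>\<omega>. exp (a * (norm (Z \<omega>))\<^sup>2))"
    using gaussian0_integrable_exp_norm_square[OF Z] by blast
  obtain C where C: "\<And>x. \<bar>\<Phi> x\<bar> \<le> C * exp (a * (norm x)\<^sup>2)"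
    using \<Phi> a(1) unfolding subgaussian_growth_def by blast
  show ?thesis
  proof (rule that)
    show "integrable M (\<lambda>\<omega>. C * exp (a * (norm (Z \<omega>))\<^sup>2))" using a(2) by (rule integrable_mult_right)
    show "\<bar>\<Phi> (rotation \<theta> (Z \<omega>))\<bar> \<le> C * exp (a * (norm (Z \<omega>))\<^sup>2)" for \<theta> \<omega>
      using C[of "rotation \<theta> (Z \<omega>)"] by (simp add: norm_rotation)
  qed
qed

text \<open>The mean value inequality bounds all difference quotients by \<open>w\<close>, so
  dominated convergence applies along every sequence of increments.\<close>

lemma has_real_derivative_integral:
  fixes F F' :: "real \<Rightarrow> 'a \<Rightarrow> real"
  assumes deriv: "\<And>t \<omega>. ((\<lambda>t. F t \<omega>) has_real_derivative F' t \<omega>) (at t)"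
    and int: "\<And>t. integrable M (F t)" and meas: "\<And>t. F' t \<in> borel_measurable M"
    and w: "integrable M w" "\<And>t \<omega>. \<bar>F' t \<omega>\<bar> \<le> w \<omega>"
  shows "((\<lambda>t. \<integral>\<omega>. F t \<omega> \<partial>M) has_real_derivative (\<integral>\<omega>. F' t \<omega> \<partial>M)) (at t)"
  unfolding DERIV_def tendsto_at_iff_sequentially comp_def
proof (intro allI impI)
  fix h :: "nat \<Rightarrow> real" assume h: "\<forall>n. h n \<in> UNIV - {0}" "h \<longlonglongrightarrow> 0"
  have "(\<lambda>n. \<integral>\<omega>. (F (t + h n) \<omega> - F t \<omega>) / h n \<partial>M) \<longlonglongrightarrow> (\<integral>\<omega>. F' t \<omega> \<partial>M)"
  proof (rule integral_dominated_convergence[OF meas _ w(1)])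
    show "(\<lambda>\<omega>. (F (t + h n) \<omega> - F t \<omega>) / h n) \<in> borel_measurable M" for n
      using int[THEN borel_measurable_integrable] by measurable
    show "AE \<omega> in M. (\<lambda>n. (F (t + h n) \<omega> - F t \<omega>) / h n) \<longlonglongrightarrow> F' t \<omega>"
      using deriv h unfolding DERIV_def tendsto_at_iff_sequentially comp_def by auto
    show "AE \<omega> in M. norm ((F (t + h n) \<omega> - F t \<omega>) / h n) \<le> w \<omega>" for n
    proof (rule AE_I2)
      fix \<omega>
      have "norm (F (t + h n) \<omega> - F t \<omega>) \<le> w \<omega> * norm (t + h n - t)"
        by (rule field_differentiable_bound[of UNIV "\<lambda>t. F t \<omega>" "\<lambda>t. F' t \<omega>"]) (use deriv w(2) in auto)
      then show "norm ((F (t + h n) \<omega> - F t \<omega>) / h n) \<le> w \<omega>"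
        using h(1) by (simp add: field_simps)
    qed
  qed
  then show "(\<lambda>n. ((\<integral>\<omega>. F (t + h n) \<omega> \<partial>M) - (\<integral>\<omega>. F t \<omega> \<partial>M)) / h n) \<longlonglongrightarrow> (\<integral>\<omega>. F' t \<omega> \<partial>M)"
    using int by simp
qed

text \<open>The chain rule pairs the velocity of the path with the gradient; integration by parts
  with \<open>U\<close> a velocity coordinate then produces second derivatives.\<close>

lemma gaussian_interpolation_derivative:
  fixes Z :: "'a \<Rightarrow> (real ^ 'n) \<times> (real ^ 'n)"
  assumes "prob_space M" and Z: "gaussian0 M Z" and f: "C2_growth f g H"
  shows "((\<lambda>\<theta>. \<integral>\<omega>. f (snd (rotation \<theta> (Z \<omega>))) \<partial>M) has_real_derivative
    (\<Sum>l\<in>UNIV. \<Sum>j\<in>UNIV. (\<integral>\<omega>. fst (rotation \<theta> (Z \<omega>)) $ l * snd (rotation \<theta> (Z \<omega>)) $ j \<partial>M) *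
      (\<integral>\<omega>. H j l (snd (rotation \<theta> (Z \<omega>))) \<partial>M))) (at \<theta>)"
proof -
  define \<Phi> where "\<Phi> z = (\<Sum>l\<in>UNIV. fst z $ l * g l (snd z))" for z :: "(real ^ 'n) \<times> (real ^ 'n)"
  note c = C2_growth_continuous[OF f]
  have sg: "subgaussian_growth f" "\<And>i. subgaussian_growth (g i)" "\<And>i j. subgaussian_growth (H i j)"
    and df: "\<And>x. (f has_derivative (\<lambda>h. \<Sum>i\<in>UNIV. h $ i * g i x)) (at x)"
    and dg: "\<And>j x. (g j has_derivative (\<lambda>h. \<Sum>i\<in>UNIV. h $ i * H i j x)) (at x)"
    using f by (auto simp: C2_growth_def)
  have fstl: "subgaussian_growth (\<lambda>z :: (real ^ 'n) \<times> (real ^ 'n). fst z $ l)" for l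
    by (intro subgaussian_growth_linear bounded_linear_compose[OF bounded_linear_vec_nth bounded_linear_fst])
  have sg\<Phi>l: "subgaussian_growth (\<lambda>z :: (real ^ 'n) \<times> (real ^ 'n). fst z $ l * g l (snd z))" for l
    by (intro subgaussian_growth_mult fstl subgaussian_growth_bounded_linear[OF bounded_linear_snd] sg)
  have c\<Phi>l: "continuous_on UNIV (\<lambda>z :: (real ^ 'n) \<times> (real ^ 'n). fst z $ l * g l (snd z))" for l
    by (intro continuous_intros continuous_on_compose2[OF c(2)]) auto
  have sg\<Phi>: "subgaussian_growth \<Phi>"
    unfolding \<Phi>_def[abs_def] by (intro subgaussian_growth_sum sg\<Phi>l)
  have c\<Phi>: "continuous_on UNIV \<Phi>"
    unfolding \<Phi>_def[abs_def] by (intro continuous_on_sum c\<Phi>l)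
  have rot: "gaussian0 M (\<lambda>\<omega>. rotation \<theta> (Z \<omega>))" for \<theta>
    by (rule gaussian0_linear_image[OF Z bounded_linear_rotation])
  have rot_snd: "gaussian0 M (\<lambda>\<omega>. snd (rotation \<theta> (Z \<omega>)))" for \<theta>
    by (rule gaussian0_linear_image[OF rot bounded_linear_snd])
  obtain w where w: "integrable M w" "\<And>\<theta> \<omega>. \<bar>\<Phi> (rotation \<theta> (Z \<omega>))\<bar> \<le> w \<omega>"
    using rotation_dominated[OF Z sg\<Phi>] by blast
  have "((\<lambda>\<theta>. \<integral>\<omega>. f (snd (rotation \<theta> (Z \<omega>))) \<partial>M) has_real_derivative
    (\<integral>\<omega>. \<Phi> (rotation \<theta> (Z \<omega>)) \<partial>M)) (at \<theta>)"
  proof (rule has_real_derivative_integral[OF _ _ _ w])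
    show "integrable M (\<lambda>\<omega>. f (snd (rotation \<theta> (Z \<omega>))))" for \<theta>
      by (rule gaussian0_integrable_continuous[OF rot_snd sg(1) c(1)])
    show "(\<lambda>\<omega>. \<Phi> (rotation \<theta> (Z \<omega>))) \<in> borel_measurable M" for \<theta>
      using gaussian0_integrable_continuous[OF rot sg\<Phi> c\<Phi>] by auto
    show "((\<lambda>\<theta>. f (snd (rotation \<theta> (Z \<omega>)))) has_real_derivative \<Phi> (rotation \<theta> (Z \<omega>))) (at \<theta>)" for \<theta> \<omega>
    proof -
      have "((\<lambda>\<theta>. snd (rotation \<theta> (Z \<omega>))) has_derivative (\<lambda>h. h *\<^sub>R fst (rotation \<theta> (Z \<omega>)))) (at \<theta>)"
        unfolding rotation_def
        by (auto intro!: derivative_eq_intros simp: algebra_simps)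
      from has_derivative_compose[OF this df]
      show ?thesis
        by (simp add: \<Phi>_def has_field_derivative_def mult.assoc sum_distrib_left[symmetric] mult_commute_abs)
    qed
  qed
  also have "(\<integral>\<omega>. \<Phi> (rotation \<theta> (Z \<omega>)) \<partial>M) =
      (\<Sum>l\<in>UNIV. \<integral>\<omega>. fst (rotation \<theta> (Z \<omega>)) $ l * g l (snd (rotation \<theta> (Z \<omega>))) \<partial>M)"
    unfolding \<Phi>_def using gaussian0_integrable_continuous[OF rot sg\<Phi>l c\<Phi>l]
    by (simp add: Bochner_Integration.integral_sum)
  also have "\<dots> = (\<Sum>l\<in>UNIV. \<Sum>j\<in>UNIV. (\<integral>\<omega>. fst (rotation \<theta> (Z \<omega>)) $ l * snd (rotation \<theta> (Z \<omega>)) $ j \<partial>M) *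
      (\<integral>\<omega>. H j l (snd (rotation \<theta> (Z \<omega>))) \<partial>M))"
  proof (intro sum.cong refl gaussian0_integration_by_parts_vec[OF assms(1)] dg sg c)
    fix l
    show "gaussian0 M (\<lambda>\<omega>. (fst (rotation \<theta> (Z \<omega>)) $ l, snd (rotation \<theta> (Z \<omega>))))"
      by (rule gaussian0_linear_image[OF rot, of "\<lambda>z. (fst z $ l, snd z)"])
        (intro bounded_linear_Pair bounded_linear_compose[OF bounded_linear_vec_nth bounded_linear_fst] bounded_linear_snd)
  qed
  finally show ?thesis .
qed

text \<open>Intended for the partial derivatives of \<open>f\<close>, to obtain continuity of the
  mean gradient along the path.\<close>

lemma gaussian_interpolation_continuous:
  fixes Z :: "'a \<Rightarrow> 'b::euclidean_space \<times> 'b"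
  assumes Z: "gaussian0 M Z" and g: "subgaussian_growth g" "continuous_on UNIV g"
  shows "continuous_on S (\<lambda>\<theta>. \<integral>\<omega>. g (snd (rotation \<theta> (Z \<omega>))) \<partial>M)"
proof -
  obtain w where w: "integrable M w" "\<And>\<theta> \<omega>. \<bar>g (snd (rotation \<theta> (Z \<omega>)))\<bar> \<le> w \<omega>"
    using rotation_dominated[OF Z subgaussian_growth_bounded_linear[OF bounded_linear_snd g(1)]] by blast
  have i: "integrable M (\<lambda>\<omega>. g (snd (rotation \<theta> (Z \<omega>))))" for \<theta>
    by (rule gaussian0_integrable_continuous[OF gaussian0_linear_image[OF gaussian0_linear_image[OF Z bounded_linear_rotation] bounded_linear_snd] g])
  have "isCont (\<lambda>\<theta>. \<integral>\<omega>. g (snd (rotation \<theta> (Z \<omega>))) \<partial>M) \<theta>" for \<theta>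
    unfolding continuous_at_sequentially comp_def
  proof (intro allI impI)
    fix u :: "nat \<Rightarrow> real" assume u: "u \<longlonglongrightarrow> \<theta>"
    show "(\<lambda>n. \<integral>\<omega>. g (snd (rotation (u n) (Z \<omega>))) \<partial>M) \<longlonglongrightarrow> (\<integral>\<omega>. g (snd (rotation \<theta> (Z \<omega>))) \<partial>M)"
    proof (rule integral_dominated_convergence[OF _ _ w(1)])
      show "AE \<omega> in M. (\<lambda>n. g (snd (rotation (u n) (Z \<omega>)))) \<longlonglongrightarrow> g (snd (rotation \<theta> (Z \<omega>)))"
      proof (rule AE_I2)
        fix \<omega>
        have "(\<lambda>n. snd (rotation (u n) (Z \<omega>))) \<longlonglongrightarrow> snd (rotation \<theta> (Z \<omega>))"
          unfolding rotation_def snd_conv by (intro tendsto_intros u)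
        then show "(\<lambda>n. g (snd (rotation (u n) (Z \<omega>)))) \<longlonglongrightarrow> g (snd (rotation \<theta> (Z \<omega>)))"
          using g(2) by (intro isCont_tendsto_compose[of _ g]) (auto simp: continuous_on_eq_continuous_at)
      qed
    qed (use i w(2) in auto)
  qed
  then show ?thesis by (simp add: continuous_at_imp_continuous_on)
qed

text \<open>Makes the interpolation formula applicable to the squared residual with \<open>q\<close>
  held fixed.\<close>

lemma C2_growth_residual_square:
  fixes f :: "real ^ 'n \<Rightarrow> real"
  assumes f: "C2_growth f g H"
  shows "C2_growth (\<lambda>x. (residual f lam q x)\<^sup>2)
    (\<lambda>l x. 2 * (residual f lam q x * (g l x - q $ l)))
    (\<lambda>j l x. 2 * ((g j x - q $ j) * (g l x - q $ l) + residual f lam q x * H j l x))"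
proof -
  note c = C2_growth_continuous[OF f] residual_growth[OF f]
  have sg: "subgaussian_growth f" "\<And>i. subgaussian_growth (g i)" "\<And>i j. subgaussian_growth (H i j)"
    and df: "\<And>x. (f has_derivative (\<lambda>h. \<Sum>i\<in>UNIV. h $ i * g i x)) (at x)"
    and dg: "\<And>j x. (g j has_derivative (\<lambda>h. \<Sum>i\<in>UNIV. h $ i * H i j x)) (at x)"
    using f by (auto simp: C2_growth_def)
  have dr: "(residual f lam q has_derivative (\<lambda>h. \<Sum>i\<in>UNIV. h $ i * (g i x - q $ i))) (at x)" for x
  proof -
    have "(\<lambda>h. \<Sum>i\<in>UNIV. h $ i * (g i x - q $ i)) = (\<lambda>h. (\<Sum>i\<in>UNIV. h $ i * g i x) - q \<bullet> h)"
      by (simp add: fun_eq_iff inner_vec_def right_diff_distrib sum_subtractf mult.commute)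
    moreover have "(residual f lam q has_derivative (\<lambda>h. (\<Sum>i\<in>UNIV. h $ i * g i x) - q \<bullet> h)) (at x)"
      unfolding residual_def[abs_def] by (auto intro!: derivative_eq_intros df)
    ultimately show ?thesis by simp
  qed
  have grad: "(\<Sum>i\<in>UNIV. h $ i * (2 * (r * u i))) = 2 * (r * (\<Sum>i\<in>UNIV. h $ i * u i))"
    for h :: "real ^ 'n" and r and u :: "'n \<Rightarrow> real"
    by (simp add: sum_distrib_left mult_ac)
  have hess: "(\<Sum>i\<in>UNIV. h $ i * (2 * (u i * v + r * w i)))
      = 2 * (r * (\<Sum>i\<in>UNIV. h $ i * w i) + (\<Sum>i\<in>UNIV. h $ i * u i) * v)"
    for h :: "real ^ 'n" and r v and u w :: "'n \<Rightarrow> real"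
  proof -
    have "(\<Sum>i\<in>UNIV. h $ i * (2 * (u i * v + r * w i)))
        = (\<Sum>i\<in>UNIV. 2 * (r * (h $ i * w i) + (h $ i * u i) * v))"
      by (intro sum.cong refl) (simp add: algebra_simps)
    then show ?thesis
      by (simp only: sum.distrib sum_distrib_left[symmetric] sum_distrib_right[symmetric])
  qed
  show ?thesis
    unfolding C2_growth_def
  proof (intro conjI allI)
    fix x
    have "((\<lambda>x. residual f lam q x * residual f lam q x) has_derivative
        (\<lambda>h. residual f lam q x * (\<Sum>i\<in>UNIV. h $ i * (g i x - q $ i)) + (\<Sum>i\<in>UNIV. h $ i * (g i x - q $ i)) * residual f lam q x)) (at x)"
      by (rule has_derivative_mult[OF dr dr])
    then show "((\<lambda>x. (residual f lam q x)\<^sup>2) has_derivative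
        (\<lambda>h. \<Sum>i\<in>UNIV. h $ i * (2 * (residual f lam q x * (g i x - q $ i))))) (at x)"
      unfolding grad by (simp add: power2_eq_square algebra_simps)
    fix j
    have "((\<lambda>x. g j x - q $ j) has_derivative (\<lambda>h. (\<Sum>i\<in>UNIV. h $ i * H i j x) - 0)) (at x)"
      by (intro has_derivative_diff dg has_derivative_const)
    from has_derivative_mult_right[OF has_derivative_mult[OF dr this], of 2]
    show "((\<lambda>x. 2 * (residual f lam q x * (g j x - q $ j))) has_derivative
        (\<lambda>h. \<Sum>i\<in>UNIV. h $ i * (2 * ((g i x - q $ i) * (g j x - q $ j) + residual f lam q x * H i j x)))) (at x)"
      unfolding hess by simp
  qed (auto intro!: continuous_intros c subgaussian_growth_intros sg)
qed

text \<open>Terms depending on one index only are annihilated by the zero marginals; this is how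
  covariances are traded for distances.\<close>

lemma sum_zero_marginals:
  fixes \<kappa> :: "'n::finite \<Rightarrow> real" and \<delta> m :: "'n \<Rightarrow> 'n \<Rightarrow> real"
  assumes "\<And>l. (\<Sum>j\<in>UNIV. m l j) = 0" "\<And>j. (\<Sum>l\<in>UNIV. m l j) = 0"
  shows "(\<Sum>l\<in>UNIV. \<Sum>j\<in>UNIV. (\<kappa> l + \<kappa> j - \<delta> l j) * m l j) = - (\<Sum>l\<in>UNIV. \<Sum>j\<in>UNIV. \<delta> l j * m l j)"
proof -
  have "(\<Sum>l\<in>UNIV. \<Sum>j\<in>UNIV. \<kappa> l * m l j) = 0"
    by (simp add: sum_distrib_left[symmetric] assms)
  moreover have "(\<Sum>l\<in>UNIV. \<Sum>j\<in>UNIV. \<kappa> j * m l j) = 0"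
    by (subst sum.swap) (simp add: sum_distrib_left[symmetric] assms)
  ultimately show ?thesis
    by (simp add: left_diff_distrib distrib_right sum.distrib sum_subtractf)
qed

text \<open>The error is proportional to the length of the step, so over an equal subdivision with
  mesh below \<open>d\<close> the errors add up to \<open>e * (b - a)\<close>.\<close>

lemma le_from_local_le:
  fixes F :: "real \<Rightarrow> real"
  assumes "a \<le> b" "d > 0"
    and step: "\<And>s t. a \<le> s \<Longrightarrow> s \<le> t \<Longrightarrow> t \<le> b \<Longrightarrow> t - s < d \<Longrightarrow> F s \<le> F t + e * (t - s)"
  shows "F a \<le> F b + e * (b - a)"
proof -
  \<comment> \<open>Strictness gives both a step length below \<open>d\<close> and
    \<open>N > 0\<close>, also when \<open>a = b\<close>.\<close>
  obtain N :: nat where N: "(b - a) / d < real N" using reals_Archimedean2 by blast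
  with assms have "N > 0" by (metis diff_ge_0_iff_ge divide_nonneg_pos gr0I not_less of_nat_0)
  define h where "h = (b - a) / real N"
  have h: "h \<ge> 0" "h < d" using N \<open>N > 0\<close> assms by (auto simp: h_def field_simps)
  have "F a \<le> F (a + real k * h) + e * (real k * h)" if "k \<le> N" for k
    using that
  proof (induction k)
    case (Suc k)
    have "real (Suc k) * h \<le> real N * h" using Suc.prems h by (intro mult_right_mono) auto
    then have "real (Suc k) * h \<le> b - a" using \<open>N > 0\<close> by (simp add: h_def)
    then have "F (a + real k * h) \<le> F (a + real (Suc k) * h) + e * ((a + real (Suc k) * h) - (a + real k * h))"
      using h by (intro step) (auto simp: algebra_simps)
    then have "F (a + real k * h) \<le> F (a + real (Suc k) * h) + e * h" by (simp add: algebra_simps)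
    then show ?case using Suc by (simp add: algebra_simps)
  qed simp
  from this[of N] show ?thesis using \<open>N > 0\<close> by (simp add: h_def)
qed

text \<open>\<open>A\<close> and \<open>B\<close> stand for the covariance matrices of the two
  endpoints, whose independence enters through \<open>cov\<close>. Row and column sums of
  \<open>H\<close> are listed separately because \<open>sum_zero_marginals\<close> takes
  both.\<close>

locale gaussian_comparison = prob_space P for P :: "'a measure" +
  fixes Z :: "'a \<Rightarrow> (real ^ 'n) \<times> (real ^ 'n)"
    and f :: "real ^ 'n \<Rightarrow> real" and g :: "'n \<Rightarrow> real ^ 'n \<Rightarrow> real"
    and H :: "'n \<Rightarrow> 'n \<Rightarrow> real ^ 'n \<Rightarrow> real" and lam :: real
    and A B :: "'n \<Rightarrow> 'n \<Rightarrow> real"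
  assumes Z: "gaussian0 P Z"
    and cov: "\<And>\<theta> l j. (\<integral>\<omega>. fst (rotation \<theta> (Z \<omega>)) $ l * snd (rotation \<theta> (Z \<omega>)) $ j \<partial>P)
      = sin \<theta> * cos \<theta> * (B l j - A l j)"
    and dist_le: "\<And>l j. A l l + A j j - 2 * A l j \<le> B l l + B j j - 2 * B l j"
    and f: "C2_growth f g H"
    and g_nonneg: "\<And>i x. g i x \<ge> 0" and sum_g: "\<And>x. (\<Sum>i\<in>UNIV. g i x) = 1"
    and H_nonpos: "\<And>i j x. i \<noteq> j \<Longrightarrow> H i j x \<le> 0"
    and sum_H: "\<And>j x. (\<Sum>i\<in>UNIV. H i j x) = 0" "\<And>i x. (\<Sum>j\<in>UNIV. H i j x) = 0"
    and f_ge: "\<And>i x. x $ i \<le> f x"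
    and lam: "\<And>i j x. i \<noteq> j \<Longrightarrow> g i x * g j x + lam * H i j x \<le> 0"
begin

section \<open>Monotonicity of the minimal squared residual along the Gaussian path\<close>

definition V :: "real \<Rightarrow> 'a \<Rightarrow> real ^ 'n" where "V \<theta> \<omega> = snd (rotation \<theta> (Z \<omega>))"

definition p :: "real \<Rightarrow> real ^ 'n" where "p \<theta> = mean_gradient P (V \<theta>) g"

definition \<Psi> :: "real \<Rightarrow> real ^ 'n \<Rightarrow> real" where
  "\<Psi> \<theta> q = (\<integral>\<omega>. (residual f lam q (V \<theta> \<omega>))\<^sup>2 \<partial>P)"

text \<open>Half of a second partial derivative of the squared residual.\<close>

definition mixed :: "real ^ 'n \<Rightarrow> 'n \<Rightarrow> 'n \<Rightarrow> real ^ 'n \<Rightarrow> real" where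
  "mixed q l j x = (g j x - q $ j) * (g l x - q $ l) + residual f lam q x * H j l x"

text \<open>The increment of the squared canonical distance from the first endpoint to the
  second.\<close>

definition \<delta> :: "'n \<Rightarrow> 'n \<Rightarrow> real" where
  "\<delta> l j = (B l l + B j j - 2 * B l j) - (A l l + A j j - 2 * A l j)"

lemma \<delta>_nonneg: "\<delta> l j \<ge> 0"
  using dist_le[of l j] by (simp add: \<delta>_def)

lemma \<delta>_diag: "\<delta> l l = 0"
  by (simp add: \<delta>_def)

lemma gaussian_V: "gaussian0 P (V \<theta>)"
  unfolding V_def[abs_def]
  by (intro gaussian0_linear_image[OF _ bounded_linear_snd] gaussian0_linear_image[OF Z bounded_linear_rotation])

lemma growth: "subgaussian_growth f" "subgaussian_growth (g i)" "subgaussian_growth (H i j)"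
  using f by (auto simp: C2_growth_def)

lemma integrable_V:
  "integrable P (\<lambda>\<omega>. g i (V \<theta> \<omega>))" "integrable P (\<lambda>\<omega>. mixed q l j (V \<theta> \<omega>))"
  using gaussian0_integrable_continuous[OF gaussian_V, of "g i"]
    gaussian0_integrable_continuous[OF gaussian_V, of "mixed q l j"]
  by (simp_all add: mixed_def[abs_def] subgaussian_growth_intros growth residual_growth[OF f]
      C2_growth_continuous[OF f] continuous_intros)

lemma p_nonneg: "p \<theta> $ i \<ge> 0"
  by (simp add: p_def mean_gradient_def g_nonneg)

lemma sum_p: "(\<Sum>i\<in>UNIV. p \<theta> $ i) = 1"
proof -
  have "(\<Sum>i\<in>UNIV. p \<theta> $ i) = (\<integral>\<omega>. (\<Sum>i\<in>UNIV. g i (V \<theta> \<omega>)) \<partial>P)"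
    using integrable_V(1) by (simp add: p_def mean_gradient_def Bochner_Integration.integral_sum)
  then show ?thesis by (simp add: sum_g prob_space)
qed

text \<open>Both the gradient and \<open>q\<close> have coordinate sum 1, so their difference sums
  to zero, as do the rows and columns of \<open>H\<close>.\<close>

lemma sum_mixed:
  assumes "(\<Sum>i\<in>UNIV. q $ i) = 1"
  shows "(\<Sum>j\<in>UNIV. mixed q l j x) = 0" "(\<Sum>l\<in>UNIV. mixed q l j x) = 0"
  unfolding mixed_def using assms
  by (simp_all add: sum.distrib sum_distrib_left[symmetric] sum_distrib_right[symmetric] sum_H sum_subtractf sum_g)

text \<open>For a probability vector \<open>q\<close>, \<open>f_ge\<close> yields q.x at most f(x),
  so the part of the residual without \<open>lam\<close> contributes a nonpositive term. The
  \<open>lam\<close> part is absorbed by the product of partial derivatives; what remains is affine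
  in \<open>g\<close>.\<close>

lemma mixed_le:
  assumes q: "\<And>i. q $ i \<ge> 0" "(\<Sum>i\<in>UNIV. q $ i) = 1" and "l \<noteq> j"
  shows "mixed q l j x \<le> q $ j * q $ l - q $ l * g j x - q $ j * g l x"
proof -
  have "q \<bullet> x = (\<Sum>i\<in>UNIV. q $ i * x $ i)" by (simp add: inner_vec_def)
  also have "\<dots> \<le> (\<Sum>i\<in>UNIV. q $ i * f x)" by (intro sum_mono mult_left_mono f_ge q)
  also have "\<dots> = f x" by (simp add: sum_distrib_right[symmetric] q)
  finally have "(f x - q \<bullet> x) * H j l x \<le> 0"
    using H_nonpos[of j l x] \<open>l \<noteq> j\<close> by (intro mult_nonneg_nonpos) auto
  moreover have "g j x * g l x + lam * H j l x \<le> 0" using lam[of j l x] \<open>l \<noteq> j\<close> by simp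
  moreover have "mixed q l j x = (g j x * g l x + lam * H j l x) + (f x - q \<bullet> x) * H j l x
      + (q $ j * q $ l - q $ l * g j x - q $ j * g l x)"
    by (simp add: mixed_def residual_def algebra_simps)
  ultimately show ?thesis by linarith
qed

text \<open>Integration replaces the affine terms in \<open>g\<close> by \<open>p \<theta>\<close>.
  Adding the nonnegative product of the two coordinates of \<open>p \<theta>\<close> completes the
  factorization.\<close>

lemma integral_mixed_le:
  assumes q: "\<And>i. q $ i \<ge> 0" "(\<Sum>i\<in>UNIV. q $ i) = 1" and "l \<noteq> j"
  shows "(\<integral>\<omega>. mixed q l j (V \<theta> \<omega>) \<partial>P) \<le> \<bar>q $ l - p \<theta> $ l\<bar> * \<bar>q $ j - p \<theta> $ j\<bar>"
proof -
  have "(\<integral>\<omega>. mixed q l j (V \<theta> \<omega>) \<partial>P) \<le>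
    (\<integral>\<omega>. q $ j * q $ l - q $ l * g j (V \<theta> \<omega>) - q $ j * g l (V \<theta> \<omega>) \<partial>P)"
    using integrable_V by (intro integral_mono mixed_le assms) auto
  also have "\<dots> = q $ j * q $ l - q $ l * p \<theta> $ j - q $ j * p \<theta> $ l"
    using integrable_V by (simp add: p_def mean_gradient_def prob_space)
  also have "\<dots> \<le> (q $ l - p \<theta> $ l) * (q $ j - p \<theta> $ j)"
    using p_nonneg[of \<theta> l] p_nonneg[of \<theta> j] by (simp add: algebra_simps)
  also have "\<dots> \<le> \<bar>q $ l - p \<theta> $ l\<bar> * \<bar>q $ j - p \<theta> $ j\<bar>"
    unfolding abs_mult[symmetric] by (rule abs_ge_self)
  finally show ?thesis .
qed

lemma \<Psi>_derivative:
  assumes q: "(\<Sum>i\<in>UNIV. q $ i) = 1"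
  shows "((\<lambda>\<theta>. \<Psi> \<theta> q) has_real_derivative
    - (sin \<theta> * cos \<theta>) * (\<Sum>l\<in>UNIV. \<Sum>j\<in>UNIV. \<delta> l j * (\<integral>\<omega>. mixed q l j (V \<theta> \<omega>) \<partial>P))) (at \<theta>)"
proof -
  let ?m = "\<lambda>l j. \<integral>\<omega>. mixed q l j (V \<theta> \<omega>) \<partial>P"
  have marg: "(\<Sum>j\<in>UNIV. ?m l j) = 0" "(\<Sum>l\<in>UNIV. ?m l j) = 0" for l j
    using integrable_V(2) sum_mixed[OF q]
    by (simp_all add: Bochner_Integration.integral_sum[symmetric])
  have "((\<lambda>\<theta>. \<Psi> \<theta> q) has_real_derivative
    (\<Sum>l\<in>UNIV. \<Sum>j\<in>UNIV. sin \<theta> * cos \<theta> * (B l j - A l j) * (2 * ?m l j))) (at \<theta>)"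
    using gaussian_interpolation_derivative[OF prob_space_axioms Z C2_growth_residual_square[OF f, of lam q], of \<theta>]
    by (simp only: \<Psi>_def V_def mixed_def cov integral_mult_right_zero)
  \<comment> \<open>Twice the covariance increment is the sum of the two variance increments minus
    \<open>\<delta> l j\<close>; the variance increments disappear by the zero marginals.\<close>
  moreover have "(\<Sum>l\<in>UNIV. \<Sum>j\<in>UNIV. sin \<theta> * cos \<theta> * (B l j - A l j) * (2 * ?m l j))
    = (sin \<theta> * cos \<theta>) * (\<Sum>l\<in>UNIV. \<Sum>j\<in>UNIV. ((B l l - A l l) + (B j j - A j j) - \<delta> l j) * ?m l j)"
    unfolding sum_distrib_left by (intro sum.cong refl) (simp add: \<delta>_def algebra_simps)
  ultimately show ?thesis
    unfolding sum_zero_marginals[OF marg, where \<kappa>="\<lambda>l. B l l - A l l"] by simp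
qed

text \<open>The error allowed in the derivative bound: quadratic in the deviation of
  \<open>q\<close> from \<open>r\<close>, and zero for \<open>q = r\<close>.\<close>

definition drift :: "real ^ 'n \<Rightarrow> real ^ 'n \<Rightarrow> real" where
  "drift q r = (\<Sum>l\<in>UNIV. \<Sum>j\<in>UNIV. \<delta> l j * (\<bar>q $ l - r $ l\<bar> * \<bar>q $ j - r $ j\<bar>))"

lemma \<Psi>_derivative_ge:
  assumes q: "\<And>i. q $ i \<ge> 0" "(\<Sum>i\<in>UNIV. q $ i) = 1" and \<theta>: "0 \<le> \<theta>" "\<theta> \<le> pi / 2"
  shows "- (sin \<theta> * cos \<theta>) * (\<Sum>l\<in>UNIV. \<Sum>j\<in>UNIV. \<delta> l j * (\<integral>\<omega>. mixed q l j (V \<theta> \<omega>) \<partial>P)) \<ge> - drift q (p \<theta>)"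
proof -
  have "sin \<theta> \<ge> 0" "cos \<theta> \<ge> 0" using \<theta> by (auto intro: sin_ge_zero cos_ge_zero)
  then have sc: "0 \<le> sin \<theta> * cos \<theta>" "sin \<theta> * cos \<theta> \<le> 1" by (auto intro: mult_le_one)
  have "(\<Sum>l\<in>UNIV. \<Sum>j\<in>UNIV. \<delta> l j * (\<integral>\<omega>. mixed q l j (V \<theta> \<omega>) \<partial>P)) \<le> drift q (p \<theta>)"
    unfolding drift_def
  proof (intro sum_mono)
    fix l j
    show "\<delta> l j * (\<integral>\<omega>. mixed q l j (V \<theta> \<omega>) \<partial>P) \<le> \<delta> l j * (\<bar>q $ l - p \<theta> $ l\<bar> * \<bar>q $ j - p \<theta> $ j\<bar>)"
      \<comment> \<open>The bound on the mixed integrals is off-diagonal only; on the diagonal the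
        weight \<open>\<delta> l l\<close> is zero.\<close>
      by (cases "l = j") (auto simp: \<delta>_diag intro!: mult_left_mono \<delta>_nonneg integral_mixed_le q)
  qed
  then have "(sin \<theta> * cos \<theta>) * (\<Sum>l\<in>UNIV. \<Sum>j\<in>UNIV. \<delta> l j * (\<integral>\<omega>. mixed q l j (V \<theta> \<omega>) \<partial>P))
    \<le> (sin \<theta> * cos \<theta>) * drift q (p \<theta>)"
    using sc by (intro mult_left_mono)
  also have "\<dots> \<le> drift q (p \<theta>)"
    using sc by (intro mult_left_le_one_le) (auto simp: drift_def intro!: sum_nonneg mult_nonneg_nonneg \<delta>_nonneg)
  finally show ?thesis by simp
qed

lemma continuous_p: "continuous_on S p"
  unfolding p_def[abs_def] mean_gradient_def V_def
  by (intro continuous_intros gaussian_interpolation_continuous[OF Z] growth C2_growth_continuous[OF f])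

lemma \<Psi>_minimal: "\<Psi> \<theta> (p \<theta>) \<le> \<Psi> \<theta> q"
  unfolding \<Psi>_def p_def by (rule integral_residual_square_minimal[OF prob_space_axioms gaussian_V f])

text \<open>With \<open>q\<close> frozen, adding the linear term \<open>e * \<theta>\<close>
  compensates the drift and makes the sum nondecreasing.\<close>

lemma \<Psi>_le:
  assumes q: "\<And>i. q $ i \<ge> 0" "(\<Sum>i\<in>UNIV. q $ i) = 1"
    and st: "0 \<le> s" "s \<le> t" "t \<le> pi / 2"
    and e: "\<And>\<xi>. s \<le> \<xi> \<Longrightarrow> \<xi> \<le> t \<Longrightarrow> drift q (p \<xi>) \<le> e"
  shows "\<Psi> s q \<le> \<Psi> t q + e * (t - s)"
proof -
  have "\<Psi> s q + e * s \<le> \<Psi> t q + e * t"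
  proof (rule DERIV_nonneg_imp_nondecreasing[OF st(2)])
    fix \<xi> assume \<xi>: "s \<le> \<xi>" "\<xi> \<le> t"
    let ?D = "- (sin \<xi> * cos \<xi>) * (\<Sum>l\<in>UNIV. \<Sum>j\<in>UNIV. \<delta> l j * (\<integral>\<omega>. mixed q l j (V \<xi> \<omega>) \<partial>P))"
    have "((\<lambda>\<theta>. \<Psi> \<theta> q + e * \<theta>) has_real_derivative ?D + e) (at \<xi>)"
      by (rule derivative_eq_intros \<Psi>_derivative[OF q(2)] refl | simp)+
    moreover have "?D + e \<ge> 0"
      using \<Psi>_derivative_ge[OF q, of \<xi>] e[OF \<xi>] \<xi> st by simp
    ultimately show "\<exists>y. ((\<lambda>\<theta>. \<Psi> \<theta> q + e * \<theta>) has_real_derivative y) (at \<xi>) \<and> 0 \<le> y" by blast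
  qed
  then show ?thesis by (simp add: algebra_simps)
qed

theorem \<Psi>_endpoints_le: "\<Psi> 0 (p 0) \<le> \<Psi> (pi / 2) (p (pi / 2))"
proof (rule field_le_epsilon)
  fix e' :: real assume "e' > 0"
  \<comment> \<open>The error rate is spread over an interval of length pi/2.\<close>
  define e where "e = e' / (pi / 2)"
  have e: "e > 0" using \<open>e' > 0\<close> by (simp add: e_def)
  define D where "D = 1 + (\<Sum>l\<in>UNIV. \<Sum>j\<in>UNIV. \<delta> l j)"
  have D: "D \<ge> 1" by (auto simp: D_def intro!: sum_nonneg \<delta>_nonneg)
  \<comment> \<open>Chosen so that \<open>D * \<eta>\<^sup>2 = e\<close>; the summand 1 in
    \<open>D\<close> keeps the quotient meaningful when all distance increments vanish.\<close>
  define \<eta> where "\<eta> = sqrt (e / D)"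
  have \<eta>: "\<eta> > 0" "\<eta>\<^sup>2 = e / D" using e D by (auto simp: \<eta>_def)
  have "uniformly_continuous_on {0..pi / 2} p"
    by (intro compact_uniformly_continuous continuous_p) auto
  then obtain d where d: "d > 0"
    "\<And>\<theta> \<xi>. \<theta> \<in> {0..pi / 2} \<Longrightarrow> \<xi> \<in> {0..pi / 2} \<Longrightarrow> dist \<xi> \<theta> < d \<Longrightarrow> dist (p \<xi>) (p \<theta>) < \<eta>"
    using \<eta>(1) unfolding uniformly_continuous_on_def by metis
  have small: "drift (p t) (p \<xi>) \<le> e" if "dist (p t) (p \<xi>) < \<eta>" for t \<xi>
  proof -
    have c: "\<bar>p t $ l - p \<xi> $ l\<bar> \<le> \<eta>" for l
      using component_le_norm_cart[of "p t - p \<xi>" l] that by (simp add: dist_norm)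
    have "drift (p t) (p \<xi>) \<le> (\<Sum>l\<in>UNIV. \<Sum>j\<in>UNIV. \<delta> l j * (\<eta> * \<eta>))"
      unfolding drift_def using \<eta>(1) by (intro sum_mono mult_left_mono mult_mono c \<delta>_nonneg) auto
    also have "\<dots> = (D - 1) * \<eta>\<^sup>2" by (simp add: D_def sum_distrib_right power2_eq_square)
    also have "\<dots> \<le> D * \<eta>\<^sup>2" by (intro mult_right_mono) auto
    also have "\<dots> = e" using D \<eta> by simp
    finally show ?thesis .
  qed
  have "\<Psi> 0 (p 0) \<le> \<Psi> (pi / 2) (p (pi / 2)) + e * (pi / 2 - 0)"
  proof (rule le_from_local_le[OF _ d(1), where F="\<lambda>\<theta>. \<Psi> \<theta> (p \<theta>)"])
    fix s t assume st: "0 \<le> s" "s \<le> t" "t \<le> pi / 2" "t - s < d"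
    \<comment> \<open>Minimality at the left end allows the competitor \<open>p t\<close>, which is
      the minimizer at the right end; only this fixed vector is then transported.\<close>
    have "\<Psi> s (p s) \<le> \<Psi> s (p t)" by (rule \<Psi>_minimal)
    also have "\<dots> \<le> \<Psi> t (p t) + e * (t - s)"
    proof (rule \<Psi>_le[OF p_nonneg sum_p st(1-3)])
      fix \<xi> assume "s \<le> \<xi>" "\<xi> \<le> t"
      then show "drift (p t) (p \<xi>) \<le> e"
        using st by (intro small d(2)) (auto simp: dist_real_def)
    qed
    finally show "\<Psi> s (p s) \<le> \<Psi> t (p t) + e * (t - s)" .
  qed simp
  then show "\<Psi> 0 (p 0) \<le> \<Psi> (pi / 2) (p (pi / 2)) + e'" by (simp add: e_def)
qed

end

section \<open>The comparison theorem\<close>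

lemma gaussian_rv_integrable:
  assumes "prob_space M" "gaussian_rv M W"
  shows "integrable M W"
proof -
  interpret prob_space M by fact
  have [measurable]: "W \<in> borel_measurable M" using assms(2) by (simp add: gaussian_rv_def)
  from assms(2) consider \<mu> where "AE \<omega> in M. W \<omega> = \<mu>"
    | \<mu> \<sigma> where "\<sigma> > 0" "distributed M lborel W (normal_density \<mu> \<sigma>)"
    by (auto simp: gaussian_rv_def)
  then show ?thesis
  proof cases
    case (1 \<mu>)
    then have "integrable M W \<longleftrightarrow> integrable M (\<lambda>_. \<mu>)" by (intro integrable_cong_AE) auto
    then show ?thesis by simp
  next
    case (2 \<mu> \<sigma>)
    then show ?thesis
      using distributed_integrable[OF 2(2), of "\<lambda>x. x"] integrable_normal_moment_nz_1[OF 2(1)] by simp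
  qed
qed

text \<open>A constant with mean zero is 0 almost surely and gives \<open>v = 0\<close>; otherwise
  dividing by the deviation reduces to the standard normal law.\<close>

lemma gaussian_rv_char:
  assumes "prob_space M" "gaussian_rv M W" "(\<integral>\<omega>. W \<omega> \<partial>M) = 0"
  shows "\<exists>v\<ge>0. \<forall>s. (CLINT \<omega>|M. iexp (s * W \<omega>)) = exp (- s\<^sup>2 * v / 2)"
proof -
  interpret prob_space M by fact
  have [measurable]: "W \<in> borel_measurable M" using assms(2) by (simp add: gaussian_rv_def)
  from assms(2) consider \<mu> where "AE \<omega> in M. W \<omega> = \<mu>"
    | \<mu> \<sigma> where "\<sigma> > 0" "distributed M lborel W (normal_density \<mu> \<sigma>)"
    by (auto simp: gaussian_rv_def)
  then show ?thesis
  proof cases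
    case (1 \<mu>)
    have "(\<integral>\<omega>. W \<omega> \<partial>M) = (\<integral>\<omega>. \<mu> \<partial>M)" using 1 by (intro integral_cong_AE) auto
    then have "\<mu> = 0" using assms(3) by (simp add: prob_space)
    have "(CLINT \<omega>|M. iexp (s * W \<omega>)) = (CLINT \<omega>|M. 1)" for s
      using 1 \<open>\<mu> = 0\<close> by (intro integral_cong_AE) auto
    then show ?thesis by (intro exI[of _ 0]) (simp add: prob_space)
  next
    case (2 \<mu> \<sigma>)
    then have "\<mu> = 0" using normal_distributed_expectation[OF 2] assms(3) by simp
    then have "distributed M lborel (\<lambda>\<omega>. (W \<omega> - 0) / \<sigma>) std_normal_density"
      using normal_standard_normal_convert[OF 2(1), of W \<mu>] 2 by simp
    then have "distr M lborel (\<lambda>\<omega>. W \<omega> / \<sigma>) = std_normal_distribution"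
      by (simp add: distributed_distr_eq_density)
    then have std: "std_normal_distribution = distr M lborel (\<lambda>\<omega>. W \<omega> / \<sigma>)" by simp
    have "(CLINT \<omega>|M. iexp (s * W \<omega>)) = exp (- s\<^sup>2 * \<sigma>\<^sup>2 / 2)" for s
    proof -
      have "(CLINT x|std_normal_distribution. iexp ((s * \<sigma>) * x)) = (CLINT \<omega>|M. iexp (s * W \<omega>))"
        unfolding std using 2(1) by (subst integral_distr) auto
      then show ?thesis
        using fun_cong[OF char_std_normal_distribution, of "s * \<sigma>"]
        by (simp add: char_def power_mult_distrib)
    qed
    then show ?thesis by (intro exI[of _ "\<sigma>\<^sup>2"]) simp
  qed
qed

text \<open>Centering is assumed for coordinates; their integrability extends it to every linear
  functional.\<close>

lemma centered_gaussian_vector_imp_gaussian0: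
  fixes X :: "'a \<Rightarrow> real ^ 'n"
  assumes "prob_space M" and X: "centered_gaussian_vector M X"
  shows "gaussian0 M X"
proof (rule gaussian0I_char[OF assms(1)])
  have rv: "gaussian_rv M (\<lambda>\<omega>. a \<bullet> X \<omega>)" for a
    using X by (simp add: centered_gaussian_vector_def gaussian_vector_def)
  show "X \<in> borel_measurable M"
    using X by (simp add: centered_gaussian_vector_def gaussian_vector_def)
  have int: "integrable M (\<lambda>\<omega>. X \<omega> $ i)" for i
    using gaussian_rv_integrable[OF assms(1) rv, of "axis i 1"] by (simp add: inner_commute inner_axis)
  fix a
  have "(\<integral>\<omega>. a \<bullet> X \<omega> \<partial>M) = (\<Sum>i\<in>UNIV. a $ i * (\<integral>\<omega>. X \<omega> $ i \<partial>M))"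
    using int by (simp add: inner_vec_def Bochner_Integration.integral_sum)
  also have "\<dots> = 0" using X by (simp add: centered_gaussian_vector_def)
  finally show "\<exists>v\<ge>0. \<forall>s. (CLINT \<omega>|M. iexp (s * (a \<bullet> X \<omega>))) = exp (- s\<^sup>2 * v / 2)"
    by (rule gaussian_rv_char[OF assms(1) rv])
qed

text \<open>Differentiation along the all-ones direction. It is used with \<open>c = 1\<close> for
  \<open>f\<close> and \<open>c = 0\<close> for its partial derivatives.\<close>

lemma sum_partial_deriv_translation:
  fixes f :: "real ^ 'n \<Rightarrow> real"
  assumes deriv: "(f has_derivative (\<lambda>h. \<Sum>i\<in>UNIV. h $ i * d i)) (at x)"
    and translation: "\<And>u. f (x + u *\<^sub>R 1) = f x + c * u"
  shows "(\<Sum>i\<in>UNIV. d i) = c"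
proof -
  have "((\<lambda>u::real. x + u *\<^sub>R 1) has_derivative (\<lambda>u. u *\<^sub>R 1)) (at 0)"
    by (auto intro!: derivative_eq_intros)
  from has_derivative_compose[OF this, of f "\<lambda>h. \<Sum>i\<in>UNIV. h $ i * d i"] deriv
  have "((\<lambda>u. f x + c * u) has_derivative (\<lambda>u. u * (\<Sum>i\<in>UNIV. d i))) (at 0)"
    by (simp add: translation sum_distrib_left)
  then have "((\<lambda>u. f x + c * u) has_real_derivative (\<Sum>i\<in>UNIV. d i)) (at 0)"
    by (simp add: has_field_derivative_def mult_commute_abs)
  moreover have "((\<lambda>u. f x + c * u) has_real_derivative c) (at 0)"
    by (auto intro!: derivative_eq_intros)
  ultimately show ?thesis by (rule DERIV_unique)
qed

section \<open>Integrals of functions of one factor of the product space\<close>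

lemma integral_pair_fst:
  fixes h :: "'a \<Rightarrow> real"
  assumes "prob_space M" "prob_space N" "integrable (M \<Otimes>\<^sub>M N) (\<lambda>z. h (fst z))"
  shows "(\<integral>z. h (fst z) \<partial>(M \<Otimes>\<^sub>M N)) = (\<integral>x. h x \<partial>M)"
proof -
  interpret M: prob_space M by fact
  interpret N: prob_space N by fact
  interpret pair_prob_space M N ..
  show ?thesis using integral_fst'[OF assms(3)] by (simp add: N.prob_space)
qed

lemma integral_pair_snd:
  fixes h :: "'b \<Rightarrow> real"
  assumes "prob_space M" "prob_space N" "integrable (M \<Otimes>\<^sub>M N) (\<lambda>z. h (snd z))"
  shows "(\<integral>z. h (snd z) \<partial>(M \<Otimes>\<^sub>M N)) = (\<integral>x. h x \<partial>N)"
proof -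
  interpret M: prob_space M by fact
  interpret N: prob_space N by fact
  interpret pair_prob_space M N ..
  show ?thesis using integral_fst'[OF assms(3)] by (simp add: M.prob_space)
qed

theorem theorem1p3:
  fixes M :: "'a measure" and N :: "'b measure"
    and X :: "'a \<Rightarrow> real ^ 'n" and Y :: "'b \<Rightarrow> real ^ 'n"
    and f :: "real ^ 'n \<Rightarrow> real" and lam :: real
  assumes "prob_space M" and "prob_space N"
    and "centered_gaussian_vector M X" and "centered_gaussian_vector N Y"
    and "\<And>i j. canonical_dist M X i j \<le> canonical_dist N Y i j"
    and "C2_fun f"
    and "moderate_growth f"
    and "\<And>i. moderate_growth (partial_deriv i f)"
    and "\<And>i j. moderate_growth (partial_deriv i (partial_deriv j f))"
    and "\<And>x u. f (x + u *\<^sub>R 1) = f x + u"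
    and "\<And>i x. partial_deriv i f x \<ge> 0"
    and "\<And>i j x. i \<noteq> j \<Longrightarrow> partial_deriv i (partial_deriv j f) x \<le> 0"
    and "\<And>x. f x \<ge> Max (range (\<lambda>i. x $ i))"
    and "\<And>i j x. i \<noteq> j \<Longrightarrow>
      partial_deriv i f x * partial_deriv j f x + lam * partial_deriv i (partial_deriv j f) x \<le> 0"
  shows "(\<integral>\<omega>. (orth_proj M (orth_compl M (gaussian_space X)) (\<lambda>\<omega>. f (X \<omega>)) \<omega> + lam)\<^sup>2 \<partial>M)
       \<le> (\<integral>\<omega>. (orth_proj N (orth_compl N (gaussian_space Y)) (\<lambda>\<omega>. f (Y \<omega>)) \<omega> + lam)\<^sup>2 \<partial>N)"
proof -
  interpret M: prob_space M by fact
  interpret N: prob_space N by fact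
  interpret MN: pair_prob_space M N ..
  define g where "g i = partial_deriv i f" for i
  define H where "H i j = partial_deriv i (partial_deriv j f)" for i j
  have f: "C2_growth f g H"
    unfolding g_def[abs_def] H_def[abs_def] by (rule C2_fun_imp_C2_growth) fact+
  have sg: "subgaussian_growth f" "\<And>i. subgaussian_growth (g i)"
    and df: "\<And>x. (f has_derivative (\<lambda>h. \<Sum>i\<in>UNIV. h $ i * g i x)) (at x)"
    and dg: "\<And>j x. (g j has_derivative (\<lambda>h. \<Sum>i\<in>UNIV. h $ i * H i j x)) (at x)"
    using f by (auto simp: C2_growth_def)
  have X: "gaussian0 M X" by (rule centered_gaussian_vector_imp_gaussian0) fact+
  have Y: "gaussian0 N Y" by (rule centered_gaussian_vector_imp_gaussian0) fact+
  define Z where "Z z = (X (fst z), Y (snd z))" for z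
  have Z: "gaussian0 (M \<Otimes>\<^sub>M N) Z"
    unfolding Z_def[abs_def] by (rule gaussian0_pair[OF assms(1,2) X Y])
  have X': "gaussian0 (M \<Otimes>\<^sub>M N) (\<lambda>z. X (fst z))"
    using gaussian0_linear_image[OF Z bounded_linear_fst] by (simp add: Z_def)
  have Y': "gaussian0 (M \<Otimes>\<^sub>M N) (\<lambda>z. Y (snd z))"
    using gaussian0_linear_image[OF Z bounded_linear_snd] by (simp add: Z_def)
  have sum_g: "(\<Sum>i\<in>UNIV. g i x) = 1" for x
    using sum_partial_deriv_translation[where f=f and x=x and c=1, OF df] assms(10) by simp
  \<comment> \<open>Translation along the all-ones vector changes \<open>f\<close> by an additive
    constant, which differentiation in an axis direction removes.\<close>
  have g_translation: "g i (x + u *\<^sub>R 1) = g i x" for i x u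
  proof -
    have d: "((\<lambda>t. f (y + t *\<^sub>R axis i 1)) has_real_derivative g i y) (at 0)" for y
    proof -
      have "((\<lambda>t::real. y + t *\<^sub>R axis i 1) has_derivative (\<lambda>t. t *\<^sub>R axis i 1)) (at 0)"
        by (auto intro!: derivative_eq_intros)
      from has_derivative_compose[OF this, of f "\<lambda>h. \<Sum>i\<in>UNIV. h $ i * g i y"] df[of y]
      show ?thesis
        by (simp add: has_field_derivative_def axis_def if_distrib if_distribR cong: if_cong)
          (simp add: mult_commute_abs)
    qed
    have "f ((x + u *\<^sub>R 1) + t *\<^sub>R axis i 1) = f (x + t *\<^sub>R axis i 1) + u" for t
      using assms(10)[of "x + t *\<^sub>R axis i 1" u] by (simp add: add_ac)
    then have "((\<lambda>t. f (x + t *\<^sub>R axis i 1) + u) has_real_derivative g i (x + u *\<^sub>R 1)) (at 0)"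
      using d[of "x + u *\<^sub>R 1"] by simp
    moreover have "((\<lambda>t. f (x + t *\<^sub>R axis i 1) + u) has_real_derivative g i x) (at 0)"
      using DERIV_add[OF d[of x] DERIV_const[of u]] by simp
    ultimately show ?thesis by (rule DERIV_unique)
  qed
  have sum_H1: "(\<Sum>i\<in>UNIV. H i j x) = 0" for j x
    using sum_partial_deriv_translation[where f="g j" and x=x and c=0, OF dg] g_translation by simp
  \<comment> \<open>The sum over the other index comes from differentiating the identity that the
    partial derivatives add up to 1.\<close>
  have sum_H2: "(\<Sum>j\<in>UNIV. H i j x) = 0" for i x
  proof -
    have "((\<lambda>x. \<Sum>j\<in>UNIV. g j x) has_derivative (\<lambda>h. \<Sum>j\<in>UNIV. \<Sum>i\<in>UNIV. h $ i * H i j x)) (at x)"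
      by (intro has_derivative_sum dg)
    then have "((\<lambda>x. 1) has_derivative (\<lambda>h. \<Sum>j\<in>UNIV. \<Sum>i\<in>UNIV. h $ i * H i j x)) (at x)"
      by (simp add: sum_g)
    then have "(\<lambda>h::real ^ 'n. \<Sum>j\<in>UNIV. \<Sum>i\<in>UNIV. h $ i * H i j x) = (\<lambda>h. 0)"
      by (rule has_derivative_unique) (rule has_derivative_const)
    from fun_cong[OF this, of "axis i 1"] show ?thesis
      by (simp add: axis_def if_distrib if_distribR cong: if_cong)
  qed
  have f_ge: "x $ i \<le> f x" for i x
    by (rule order_trans[OF Max_ge assms(13)]) auto
  have int: "integrable (M \<Otimes>\<^sub>M N) (\<lambda>z. X (fst z) $ l * X (fst z) $ j)"
    "integrable (M \<Otimes>\<^sub>M N) (\<lambda>z. Y (snd z) $ l * Y (snd z) $ j)"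
    "integrable (M \<Otimes>\<^sub>M N) (\<lambda>z. X (fst z) $ l * Y (snd z) $ j)" for l j
    using gaussian0_integrable_continuous[OF X', of "\<lambda>x. x $ l * x $ j"]
      gaussian0_integrable_continuous[OF Y', of "\<lambda>x. x $ l * x $ j"]
      gaussian0_integrable_continuous[OF Z, of "\<lambda>z. fst z $ l * snd z $ j"]
    by (simp_all add: Z_def subgaussian_growth_intros subgaussian_growth_vec_linear continuous_intros
      subgaussian_growth_bounded_linear[OF bounded_linear_fst subgaussian_growth_vec_linear(1)]
      subgaussian_growth_bounded_linear[OF bounded_linear_snd subgaussian_growth_vec_linear(1)])
  have EY: "(\<integral>\<omega>. Y \<omega> $ j \<partial>N) = 0" for j
    using assms(4) by (simp add: centered_gaussian_vector_def)
  have cross: "(\<integral>z. X (fst z) $ l * Y (snd z) $ j \<partial>(M \<Otimes>\<^sub>M N)) = 0" for l j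
    using MN.integral_fst'[OF int(3)] EY by simp
  define A where "A l j = (\<integral>z. X (fst z) $ l * X (fst z) $ j \<partial>(M \<Otimes>\<^sub>M N))" for l j
  define B where "B l j = (\<integral>z. Y (snd z) $ l * Y (snd z) $ j \<partial>(M \<Otimes>\<^sub>M N))" for l j
  have square_diff: "(a - b)\<^sup>2 = a * a + b * b - 2 * (a * b)" for a b :: real
    by (simp add: power2_eq_square algebra_simps)
  have distA: "(\<integral>\<omega>. (X \<omega> $ l - X \<omega> $ j)\<^sup>2 \<partial>M) = A l l + A j j - 2 * A l j" for l j
  proof -
    have "(\<integral>z. (X (fst z) $ l - X (fst z) $ j)\<^sup>2 \<partial>(M \<Otimes>\<^sub>M N)) = (\<integral>\<omega>. (X \<omega> $ l - X \<omega> $ j)\<^sup>2 \<partial>M)"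
      using gaussian0_integrable_continuous[OF X', of "\<lambda>x. (x $ l - x $ j)\<^sup>2"]
      by (intro integral_pair_fst[OF assms(1,2)])
        (simp add: subgaussian_growth_intros subgaussian_growth_vec_linear continuous_intros)
    moreover have "(\<integral>z. (X (fst z) $ l - X (fst z) $ j)\<^sup>2 \<partial>(M \<Otimes>\<^sub>M N)) = A l l + A j j - 2 * A l j"
      using int(1) by (simp add: A_def square_diff)
    ultimately show ?thesis by simp
  qed
  have distB: "(\<integral>\<omega>. (Y \<omega> $ l - Y \<omega> $ j)\<^sup>2 \<partial>N) = B l l + B j j - 2 * B l j" for l j
  proof -
    have "(\<integral>z. (Y (snd z) $ l - Y (snd z) $ j)\<^sup>2 \<partial>(M \<Otimes>\<^sub>M N)) = (\<integral>\<omega>. (Y \<omega> $ l - Y \<omega> $ j)\<^sup>2 \<partial>N)"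
      using gaussian0_integrable_continuous[OF Y', of "\<lambda>x. (x $ l - x $ j)\<^sup>2"]
      by (intro integral_pair_snd[OF assms(1,2)])
        (simp add: subgaussian_growth_intros subgaussian_growth_vec_linear continuous_intros)
    moreover have "(\<integral>z. (Y (snd z) $ l - Y (snd z) $ j)\<^sup>2 \<partial>(M \<Otimes>\<^sub>M N)) = B l l + B j j - 2 * B l j"
      using int(2) by (simp add: B_def square_diff)
    ultimately show ?thesis by simp
  qed
  interpret C: gaussian_comparison "M \<Otimes>\<^sub>M N" Z f g H lam A B
  proof
    fix \<theta> l j
    \<comment> \<open>After expansion the terms with squared cosine and squared sine mix
      \<open>X\<close> and \<open>Y\<close>, and have mean zero by \<open>cross\<close>.\<close>
    have "fst (rotation \<theta> (Z z)) $ l * snd (rotation \<theta> (Z z)) $ j =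
        (cos \<theta>)\<^sup>2 * (X (fst z) $ j * Y (snd z) $ l) + sin \<theta> * cos \<theta> * (Y (snd z) $ l * Y (snd z) $ j)
        - sin \<theta> * cos \<theta> * (X (fst z) $ l * X (fst z) $ j) - (sin \<theta>)\<^sup>2 * (X (fst z) $ l * Y (snd z) $ j)" for z
      by (simp add: rotation_def Z_def algebra_simps power2_eq_square)
    then show "(\<integral>z. fst (rotation \<theta> (Z z)) $ l * snd (rotation \<theta> (Z z)) $ j \<partial>(M \<Otimes>\<^sub>M N))
        = sin \<theta> * cos \<theta> * (B l j - A l j)"
      using int by (simp add: cross A_def B_def right_diff_distrib)
    show "A l l + A j j - 2 * A l j \<le> B l l + B j j - 2 * B l j"
      using assms(5)[of l j] unfolding canonical_dist_def distA distB by simp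
  next
    fix i j :: 'n and x assume "i \<noteq> j"
    then show "H i j x \<le> 0" "g i x * g j x + lam * H i j x \<le> 0"
      using assms(12,14) by (auto simp: g_def H_def)
  qed (use Z f sum_g sum_H1 sum_H2 f_ge assms(11) in \<open>auto simp: g_def\<close>)
  \<comment> \<open>The path starts at \<open>X\<close> and ends at \<open>Y\<close>, so the
    endpoint inequality for the locale can be read on the original spaces.\<close>
  have rot: "snd (rotation 0 (Z z)) = X (fst z)" "snd (rotation (pi / 2) (Z z)) = Y (snd z)" for z
    by (simp_all add: rotation_def Z_def)
  note cont = C2_growth_continuous[OF f] and rg = residual_growth[OF f]
  have "C.p 0 = mean_gradient M X g"
    unfolding C.p_def mean_gradient_def C.V_def rot
    using integral_pair_fst[OF assms(1,2) gaussian0_integrable_continuous[OF X' sg(2) cont(2)]] by simp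
  moreover have "C.\<Psi> 0 q = (\<integral>\<omega>. (residual f lam q (X \<omega>))\<^sup>2 \<partial>M)" for q
    unfolding C.\<Psi>_def C.V_def rot
    using gaussian0_integrable_continuous[OF X', of "\<lambda>x. (residual f lam q x)\<^sup>2"]
    by (intro integral_pair_fst[OF assms(1,2)]) (simp add: subgaussian_growth_power continuous_intros rg)
  moreover have "C.p (pi / 2) = mean_gradient N Y g"
    unfolding C.p_def mean_gradient_def C.V_def rot
    using integral_pair_snd[OF assms(1,2) gaussian0_integrable_continuous[OF Y' sg(2) cont(2)]] by simp
  moreover have "C.\<Psi> (pi / 2) q = (\<integral>\<omega>. (residual f lam q (Y \<omega>))\<^sup>2 \<partial>N)" for q
    unfolding C.\<Psi>_def C.V_def rot
    using gaussian0_integrable_continuous[OF Y', of "\<lambda>x. (residual f lam q x)\<^sup>2"]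
    by (intro integral_pair_snd[OF assms(1,2)]) (simp add: subgaussian_growth_power continuous_intros rg)
  ultimately show ?thesis
    using C.\<Psi>_endpoints_le
    unfolding integral_orth_proj_residual[OF assms(1) X f] integral_orth_proj_residual[OF assms(2) Y f]
    by simp
qed

end
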